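(* Let $p$ be an odd prime, let $m,\alpha$ be positive integers, and put $e=2m$, $q=p^{e}$, $d=\gcd(\alpha,e)$. Suppose that $\frac{m}{d}$ is odd, and let $c\in\mathbb{F}_p$ with $c\neq 0$. Let $D=\{x\in\mathbb{F}_q^{*}: Tr(x^{p^{\alpha}+1})=0\}=\{d_1,\dots,d_n\}$ and let $$\mathcal{C}_D=\{(Tr(xd_1)+c,Tr(xd_2)+c,\dots,Tr(xd_n)+c): x\in\mathbb{F}_q\}.$$ Then $\mathcal{C}_D$ is a $[p^{e-1}-(p-1)p^{m-1}-1,\;e+1]$ linear code over $\mathbb{F}_p$ whose weight distribution is: - weight $(p-1)(p^{e-2}-p^{m-1})-1$ with multiplicity $p^{e-1}-(p-1)p^{m-1}-1$; - weight $(p-1)p^{e-2}-(p-2)p^{m-1}-1$ with multiplicity $(p-1)(p^{e-1}+p^{m-1})$; - weight $p^{e-1}-(p-1)p^{m-1}-1$ with multiplicity $1$; and whose complete weight enumerator is $$\begin{aligned}\mathit{CWE}(\mathcal{C}_{D})={}&w_{c}^{p^{e-1}-(p-1)p^{m-1}-1}+\bigl(p^{e-1}-(p-1)p^{m-1}-1\bigr)\,w_{c}^{p^{e-2}-(p-1)p^{m-1}-1}\prod_{\substack{0\le i\le p-1\\ i\ne c}}w_{i}^{p^{e-2}}\\&+(p-1)(p^{e-1}+p^{m-1})\,w_{c}^{p^{e-2}-1}\prod_{\substack{0\le i\le p-1\\ i\ne c}}w_{i}^{p^{e-2}-p^{m-1}}.\end{aligned}$$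
   Context: $Tr$ denotes the trace function from $\mathbb{F}_q$ to $\mathbb{F}_p$. An $[n,k]$ linear code over $\mathbb{F}_p$ is a $k$-dimensional subspace of $\mathbb{F}_p^{n}$. Elements of $\mathbb{F}_p$ are identified with $0,1,\dots,p-1$. For a codeword $\mathbf{c}\in\mathbb{F}_p^{n}$, its complete weight enumerator is the monomial $w(\mathbf{c})=w_0^{t_0}w_1^{t_1}\cdots w_{p-1}^{t_{p-1}}$ in the unknowns $w_0,\dots,w_{p-1}$, where $t_i$ is the number of components of $\mathbf{c}$ equal to $i$; the complete weight enumerator of a code $\mathcal{C}$ is $\mathit{CWE}(\mathcal{C})=\sum_{\mathbf{c}\in\mathcal{C}}w(\mathbf{c})$. The weight distribution gives, for each Hamming weight, the number (multiplicity) of codewords having that weight.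
   Formalization: For fixed c the set C_D is a translate without the zero word, never linear; the [n, e+1] claim is proved for its linear span, the weight distribution and CWE for C_D itself; m = 1, where D is empty and the formulas fail, is excluded. *)

theory Defs
  imports
    "HOL-Analysis.Cartesian_Space"
    "HOL-Library.Poly_Mapping"
    "Berlekamp_Zassenhaus.Finite_Field"
begin

text \<open>
  The field with \<open>p\<close> elements is \<open>'p mod_ring\<close> (integers modulo \<open>p = CARD('p)\<close>, represented by
  \<open>0, \<dots>, p - 1\<close>), and the field with \<open>p ^ e\<close> elements is any finite field \<open>'b\<close> of that
  cardinality. The embedding below is a ring homomorphism whenever \<open>'b\<close> has characteristic \<open>p\<close>.
\<close>

definition prime_field_embed :: "'p::prime_card mod_ring \<Rightarrow> 'b::field" where
  "prime_field_embed a = of_int (to_int_mod_ring a)"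

text \<open>
  Absolute trace \<open>x + x^p + \<dots> + x^(p^(e-1))\<close>. The sum lies in the prime subfield of \<open>'b\<close>, so it is
  the image of exactly one element of \<open>'p mod_ring\<close> when \<open>CARD('b) = CARD('p) ^ e\<close>.
\<close>

definition field_trace :: "nat \<Rightarrow> 'b::{field,finite} \<Rightarrow> 'p::prime_card mod_ring" where
  "field_trace e x = (THE a. prime_field_embed a = (\<Sum>i<e. x ^ (CARD('p) ^ i)))"

definition linear_code :: "nat \<Rightarrow> nat \<Rightarrow> ('k::field ^ 'n) set \<Rightarrow> bool" where
  "linear_code n k C \<longleftrightarrow> CARD('n) = n \<and> vec.subspace C \<and> vec.dim C = k"

definition symbol_count :: "'k ^ 'n \<Rightarrow> 'k \<Rightarrow> nat" where
  "symbol_count v a = card {j. v $ j = a}"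

definition hamming_weight :: "'k::zero ^ 'n \<Rightarrow> nat" where
  "hamming_weight v = card {j. v $ j \<noteq> 0}"

definition weight_multiplicity :: "('k::zero ^ 'n) set \<Rightarrow> nat \<Rightarrow> nat" where
  "weight_multiplicity C w = card {v \<in> C. hamming_weight v = w}"

text \<open>
  Integer polynomials in unknowns indexed by \<open>'k\<close>: finitely supported maps from exponent vectors
  to coefficients, with the convolution product of \<open>Poly_Mapping\<close>.
\<close>

type_synonym 'k mpoly_int = "('k \<Rightarrow>\<^sub>0 nat) \<Rightarrow>\<^sub>0 int"

definition unknown :: "'k \<Rightarrow> 'k mpoly_int" where
  "unknown i = Poly_Mapping.single (Poly_Mapping.single i 1) 1"

definition complete_weight_enumerator :: "('k::finite ^ 'n) set \<Rightarrow> 'k mpoly_int" where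
  "complete_weight_enumerator C = (\<Sum>v\<in>C. \<Prod>i\<in>UNIV. unknown i ^ symbol_count v i)"

definition defining_set :: "'p::prime_card itself \<Rightarrow> nat \<Rightarrow> nat \<Rightarrow> 'b::{field,finite} set" where
  "defining_set _ e \<alpha> =
     {x. x \<noteq> 0 \<and> (field_trace e (x ^ (CARD('p) ^ \<alpha> + 1)) :: 'p mod_ring) = 0}"

text \<open>
  The words \<open>(Tr(x d\<^sub>1) + c, \<dots>, Tr(x d\<^sub>n) + c)\<close> for an enumeration \<open>d\<close> of the defining set by the
  coordinate type \<open>'n\<close>. Types are nonempty, so such an enumeration exists only for a nonempty
  defining set. For \<open>e = 2 m\<close>, \<open>d = gcd \<alpha> e\<close> and \<open>m / d\<close> an odd integer, the defining set is empty
  exactly if \<open>m = 1\<close>; for \<open>m \<ge> 2\<close> subtraction on \<open>nat\<close> does not truncate in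
  \<open>p^(e-2) - (p-1) p^(m-1) - 1\<close> and the similar parameters of the code.

  For \<open>c \<noteq> 0\<close> this set of \<open>p ^ e\<close> words is a translate of the linear code obtained for \<open>c = 0\<close>; it
  does not contain the zero word. The linear code attached to it is its linear span
  \<open>{(Tr(x d\<^sub>1) + b, \<dots>, Tr(x d\<^sub>n) + b) | x b}\<close>.
\<close>

definition code_words ::
  "nat \<Rightarrow> 'p::prime_card mod_ring \<Rightarrow> ('n \<Rightarrow> 'b::{field,finite}) \<Rightarrow> ('p mod_ring ^ 'n) set" where
  "code_words e c d = {(\<chi> j. field_trace e (x * d j) + c) | x. True}"

end

theory Submission
  imports Defs
begin

text \<open>
  The function \<open>Q v = Tr (v^(p^\<alpha> + 1))\<close> is a quadratic form over the prime field. It is nondegenerate: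
  an element \<open>u\<close> of the radical satisfies \<open>u^(p^(2 \<alpha>)) = - u\<close>, and iterating this \<open>m / d\<close> times, an odd
  number, gives \<open>u = - u\<close>. Multiplication by suitable \<open>z\<close> with \<open>z^(p^d + 1)\<close> in the prime field shows that
  \<open>Q\<close> takes all nonzero values equally often, say \<open>N\<close> times. Counting the pairs with \<open>Q x = Q y\<close> gives
  \<open>(q - p N)\<^sup>2 = q\<close>, and the sign of the root follows from \<open>p^d + 1 dvd N\<close>, which holds because the
  roots of unity of order \<open>p^d + 1\<close> act freely on the level set. The number of isotropic \<open>v\<close> with a
  prescribed value of the polar form at \<open>(u, v)\<close> then follows by double counting, without character
  sums, and this number is the multiplicity of a symbol in a codeword.
\<close>

section \<open>Quadratic forms over finite fields\<close>

lemma sum_card_fibres: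
  fixes f :: "'a \<Rightarrow> 'c::finite"
  assumes "finite A"
  shows "(\<Sum>b\<in>UNIV. card {v \<in> A. f v = b}) = card A"
proof -
  have "card A = (\<Sum>b\<in>UNIV. \<Sum>v | v \<in> A \<and> f v = b. 1)"
    using assms by (subst sum.group) auto
  then show ?thesis by simp
qed

lemma sum_const_off_zero:
  fixes f :: "'a::{zero,finite} \<Rightarrow> nat"
  assumes "\<And>a. a \<noteq> 0 \<Longrightarrow> f a = C"
  shows "(\<Sum>a\<in>UNIV. f a) = f 0 + (CARD('a) - 1) * C"
proof -
  have "(\<Sum>a\<in>UNIV. f a) = f 0 + (\<Sum>a\<in>UNIV - {0 :: 'a}. C)"
    using assms by (subst sum.remove[of _ "0 :: 'a"]) (auto intro!: sum.cong)
  then show ?thesis by (simp add: card_Diff_subset)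
qed

text \<open>Adjoining \<open>a\<close> outside the span multiplies the size by the number of
  scalars, because \<open>scale k a + s\<close> determines both \<open>k\<close> and
  \<open>s\<close>.\<close>

lemma (in vector_space) card_span_independent:
  assumes "finite B" "independent B" "finite (UNIV :: 'a set)"
  shows "finite (span B) \<and> card (span B) = card (UNIV :: 'a set) ^ card B"
  using assms(1,2)
proof (induction B rule: finite_induct)
  case (insert a B)
  then have nin: "a \<notin> span B" and ind: "independent B"
    by (auto simp: independent_insert)
  let ?f = "\<lambda>(k, s). scale k a + s"
  have inj: "inj_on ?f (UNIV \<times> span B)"
  proof (rule inj_onI, clarify)
    fix k s k' s'
    assume s: "s \<in> span B" "s' \<in> span B" and eq: "scale k a + s = scale k' a + s'"
    have "scale (k - k') a = s' - s"
      using eq by (simp add: scale_left_diff_distrib algebra_simps)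
    then have "scale (k - k') a \<in> span B"
      using s by (simp add: span_diff)
    then have "k = k'"
      using nin by (metis eq_iff_diff_eq_0 span_scale scale_scale left_inverse scale_one)
    then show "k = k' \<and> s = s'" using eq by simp
  qed
  have "span (insert a B) = ?f ` (UNIV \<times> span B)"
  proof
    show "span (insert a B) \<subseteq> ?f ` (UNIV \<times> span B)"
    proof
      fix x assume "x \<in> span (insert a B)"
      then obtain k where "x - scale k a \<in> span B" by (auto simp: span_insert)
      moreover have "x = ?f (k, x - scale k a)" by simp
      ultimately show "x \<in> ?f ` (UNIV \<times> span B)" by (metis SigmaI UNIV_I imageI)
    qed
    have "scale k a + s \<in> span (insert a B)" if "s \<in> span B" for k s
      using that span_mono[of B "insert a B"] by (auto intro: span_add span_scale span_base)
    then show "?f ` (UNIV \<times> span B) \<subseteq> span (insert a B)" by auto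
  qed
  then show ?case
    using insert.IH[OF ind] insert.hyps inj assms(3)
    by (simp add: card_image card_cartesian_product)
qed auto

text \<open>Lets the dimension of the spanned code be read off its number of words.\<close>

lemma (in vector_space) card_subspace:
  assumes "subspace S" "finite S" "finite (UNIV :: 'a set)"
  shows "card S = card (UNIV :: 'a set) ^ dim S"
proof -
  obtain B where B: "B \<subseteq> S" "independent B" "S \<subseteq> span B" "card B = dim S"
    using basis_exists by blast
  have "span B = S"
    using B assms(1) by (simp add: span_minimal subset_antisym)
  moreover have "finite B"
    using B(1) assms(2) finite_subset by blast
  ultimately show ?thesis
    using card_span_independent[of B] B assms(3) by auto
qed

text \<open>Equidistribution of the nonzero values is a genuine restriction: the form x^2 on the
  field with three elements violates it. For the trace form it comes from similitudes, and it stands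
  in for a classification of quadratic forms.\<close>

locale finite_quadratic_space = vector_space scale
  for scale :: "'k::{field,finite} \<Rightarrow> 'v::{ab_group_add,finite} \<Rightarrow> 'v" +
  fixes Q :: "'v \<Rightarrow> 'k" and B :: "'v \<Rightarrow> 'v \<Rightarrow> 'k"
  assumes Q_add: "Q (u + v) = Q u + Q v + B u v"
    and Q_scale: "Q (scale a v) = a\<^sup>2 * Q v"
    and B_add: "B u (v + w) = B u v + B u w"
    and B_scale: "B u (scale a v) = a * B u v"
    and nondegenerate: "u \<noteq> 0 \<Longrightarrow> \<exists>v. B u v \<noteq> 0"
    and two_nonzero: "(2 :: 'k) \<noteq> 0"
    and equidistributed: "a \<noteq> 0 \<Longrightarrow> card {v. Q v = a} = card {v. Q v = 1}"
begin

section \<open>The polar form and the sizes of the level sets\<close>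

lemma B_commute: "B u v = B v u"
  using Q_add[of u v] Q_add[of v u] by (simp add: add.commute)

lemma B_zero_left [simp]: "B 0 v = 0"
  using B_scale[of v 0 0] by (simp add: B_commute)

lemma Q_zero [simp]: "Q 0 = 0"
  using Q_scale[of 0 0] by simp

lemma B_diff_right: "B u (v - w) = B u v - B u w"
  using B_add[of u "v - w" w] by simp

text \<open>Turns the condition \<open>Q u = Q v\<close> into orthogonality of sum and
  difference.\<close>

lemma B_diff_self: "B (u + v) (u - v) = 2 * (Q u - Q v)"
proof -
  have BQ: "B x x = 2 * Q x" for x
  proof -
    have "scale 2 x = x + x" using scale_left_distrib[of 1 1 x] by simp
    then show ?thesis using Q_add[of x x] Q_scale[of 2 x] by simp
  qed
  have "B (u + v) (u - v) = B u (u + v) - B v (u + v)"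
    by (metis B_commute B_diff_right)
  then show ?thesis
    by (simp add: B_add BQ B_commute[of v u] algebra_simps)
qed

text \<open>All fibres of the linear form \<open>B u\<close> are translates of one another, by a
  multiple of a vector on which \<open>B u\<close> does not vanish.\<close>

lemma card_hyperplane:
  assumes "u \<noteq> 0"
  shows "CARD('k) * card {v. B u v = b} = CARD('v)"
proof -
  have eq: "card {v. B u v = b'} = card {v. B u v = b}" for b'
  proof -
    obtain v where "B u v \<noteq> 0" using nondegenerate assms by blast
    define w where "w = scale ((b' - b) / B u v) v"
    have w: "B u w = b' - b" using \<open>B u v \<noteq> 0\<close> by (simp add: w_def B_scale)
    show ?thesis
      by (rule bij_betw_same_card[of "\<lambda>x. x - w"],
          rule bij_betw_byWitness[where f' = "\<lambda>x. x + w"]) (auto simp: B_add B_diff_right w)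
  qed
  have "CARD('v) = (\<Sum>b'\<in>UNIV. card {v. B u v = b'})"
    using sum_card_fibres[of UNIV "B u"] by simp
  also have "\<dots> = (\<Sum>b'\<in>(UNIV :: 'k set). card {v. B u v = b})"
    by (rule sum.cong[OF refl eq])
  finally show ?thesis by simp
qed

text \<open>\<open>u = 0\<close> is orthogonal to everything, and every other \<open>u\<close> to a
  hyperplane. The factor \<open>CARD('k)\<close> avoids a division.\<close>

lemma card_orthogonal_pairs:
  "int CARD('k) * int (card {(u, v). B u v = 0})
    = int CARD('k) * int CARD('v) + (int CARD('v) - 1) * int CARD('v)"
proof -
  have "{(u, v). B u v = 0} = Sigma UNIV (\<lambda>u. {v. B u v = 0})" by auto
  then have "card {(u, v). B u v = 0} = (\<Sum>u\<in>UNIV. card {v. B u v = 0})"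
    by simp
  then have "CARD('k) * card {(u, v). B u v = 0} = (\<Sum>u\<in>UNIV. CARD('k) * card {v. B u v = 0})"
    by (simp only: sum_distrib_left)
  also have "\<dots> = CARD('k) * CARD('v) + (CARD('v) - 1) * CARD('v)"
    by (subst sum_const_off_zero[OF card_hyperplane]) simp_all
  finally have "int (CARD('k) * card {(u, v). B u v = 0})
      = int (CARD('k) * CARD('v) + (CARD('v) - 1) * CARD('v))"
    by simp
  then show ?thesis by (simp add: of_nat_diff Suc_leI)
qed

text \<open>The left side counts pairs with \<open>Q x = Q y\<close>. The substitution (x + y, x -
  y), invertible because 2 is, maps them onto the orthogonal pairs.\<close>

lemma sum_card_squares: "(\<Sum>a\<in>UNIV. (card {v. Q v = a})\<^sup>2) = card {(u, v). B u v = 0}"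
proof -
  let ?S = "{(x, y). Q x = Q y}"
  have *: "{w \<in> ?S. Q (fst w) = a} = {v. Q v = a} \<times> {v. Q v = a}" for a by auto
  have "(\<Sum>a\<in>UNIV. (card {v. Q v = a})\<^sup>2) = card ?S"
    using sum_card_fibres[of ?S "\<lambda>w. Q (fst w)"]
    unfolding * by (simp add: card_cartesian_product power2_eq_square)
  also have "\<dots> = card {(u, v). B u v = 0}"
  proof (rule bij_betw_same_card)
    let ?h = "\<lambda>x. scale (1 / 2) x"
    have "1 / 2 + 1 / 2 = (1 :: 'k)"
      using two_nonzero by (metis add_divide_distrib divide_self one_add_one)
    then have h: "?h x + ?h x = x" for x
      by (metis scale_left_distrib scale_one)
    have hd: "?h (x + y) + ?h (x - y) = x" "?h (x + y) - ?h (x - y) = y" for x y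
      using h[of x] h[of y] by (simp_all add: scale_right_distrib scale_right_diff_distrib)
    have dd: "?h (x + x) = x" for x
      using h[of x] by (simp add: scale_right_distrib)
    have dh: "?h (x + y + (x - y)) = x" "?h (x + y - (x - y)) = y" for x y
      using h[of x] h[of y] by (simp_all add: scale_right_distrib)
    show "bij_betw (\<lambda>(x, y). (x + y, x - y)) ?S {(u, v). B u v = 0}"
    proof (rule bij_betw_byWitness[where f' = "\<lambda>(u, v). (?h (u + v), ?h (u - v))"])
      show "(\<lambda>(u, v). (?h (u + v), ?h (u - v))) ` {(u, v). B u v = 0} \<subseteq> ?S"
      proof clarsimp
        fix u v assume "B u v = 0"
        then show "Q (?h (u + v)) = Q (?h (u - v))"
          using B_diff_self[of "?h (u + v)" "?h (u - v)"] two_nonzero by (simp add: hd)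
      qed
    qed (auto simp: B_diff_self hd dh dd)
  qed
  finally show ?thesis .
qed

lemma card_level_sum: "card {v. Q v = 0} + (CARD('k) - 1) * card {v. Q v = 1} = CARD('v)"
proof -
  have "CARD('v) = (\<Sum>a\<in>UNIV. card {v. Q v = a})"
    using sum_card_fibres[of UNIV Q] by simp
  also have "\<dots> = card {v. Q v = 0} + (CARD('k) - 1) * card {v. Q v = 1}"
    by (subst sum_const_off_zero[OF equidistributed]) auto
  finally show ?thesis by simp
qed

lemma card_field_gt_1: "CARD('k) > 1"
  using card_mono[of UNIV "{0, 1 :: 'k}"] by simp

text \<open>The sum and the sum of squares of the level sizes are known, and only two sizes occur.
  Eliminating the size of the zero level leaves a quadratic equation for the other one.\<close>

lemma level_deviation_square:
  "(int CARD('v) - int CARD('k) * int (card {v. Q v = 1}))\<^sup>2 = int CARD('v)"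
proof -
  define r q N0 N1 where "r = int CARD('k)" and "q = int CARD('v)"
    and "N0 = int (card {v. Q v = 0})" and "N1 = int (card {v. Q v = 1})"
  have r: "r > 1" using card_field_gt_1 by (simp add: r_def)
  have 1: "N0 + (r - 1) * N1 = q"
    using arg_cong[OF card_level_sum, of int] card_field_gt_1
    by (simp add: N0_def N1_def q_def r_def of_nat_diff)
  have "(\<Sum>a\<in>UNIV. (card {v. Q v = a})\<^sup>2)
      = (card {v. Q v = 0})\<^sup>2 + (CARD('k) - 1) * (card {v. Q v = 1})\<^sup>2"
    by (rule sum_const_off_zero) (subst equidistributed, simp_all)
  then have "int (card {(u, v). B u v = 0}) = N0\<^sup>2 + (r - 1) * N1\<^sup>2"
    using card_field_gt_1 sum_card_squares
    by (simp add: N0_def N1_def r_def of_nat_diff)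
  then have 2: "r * (N0\<^sup>2 + (r - 1) * N1\<^sup>2) = r * q + (q - 1) * q"
    using card_orthogonal_pairs by (simp add: r_def q_def)
  have N0: "N0 = q - (r - 1) * N1" using 1 by simp
  \<comment> \<open>After substitution of \<open>N0\<close>, fact 2 makes the right side vanish; the
    factor \<open>r - 1\<close> is positive and cancels.\<close>
  have "(r - 1) * ((q - r * N1)\<^sup>2 - q) = r * (N0\<^sup>2 + (r - 1) * N1\<^sup>2) - (r * q + (q - 1) * q)"
    unfolding N0 by (simp add: power2_eq_square algebra_simps)
  then show ?thesis using 2 r by (simp add: r_def q_def N1_def)
qed

section \<open>Isotropic vectors in the sections of a linear form\<close>

text \<open>
  Counting pairs \<open>(v, z)\<close> with \<open>Q v + z * B u v = 0\<close> in two ways: for fixed \<open>z\<close>, completing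
  the square turns the equation into \<open>Q (v + z u) = z\<^sup>2 * Q u\<close>; for fixed \<open>v\<close>, it is linear in \<open>z\<close>.
\<close>

lemma sum_levels_eq:
  "(\<Sum>z\<in>UNIV. card {v. Q v = z\<^sup>2 * Q u})
    = card {v. B u v \<noteq> 0} + CARD('k) * card {v. Q v = 0 \<and> B u v = 0}"
proof -
  let ?S = "{(v, z). Q v + z * B u v = 0}"
  have Qu: "Q (v + scale z u) = Q v + z * B u v + z\<^sup>2 * Q u" for v z
    by (simp add: Q_add B_scale Q_scale B_commute[of u])
  have "card {v. Q v = z\<^sup>2 * Q u} = card {w \<in> ?S. snd w = z}" for z
  proof (rule bij_betw_same_card)
    have shift: "Q (v - scale z u) + z * B u (v - scale z u) = Q v - z\<^sup>2 * Q u" for v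
      using Qu[of "v - scale z u" z] by (simp add: eq_diff_eq)
    show "bij_betw (\<lambda>v. (v - scale z u, z)) {v. Q v = z\<^sup>2 * Q u} {w \<in> ?S. snd w = z}"
      by (rule bij_betw_byWitness[where f' = "\<lambda>(v, z). v + scale z u"]) (auto simp: Qu shift)
  qed
  then have "(\<Sum>z\<in>UNIV. card {v. Q v = z\<^sup>2 * Q u}) = card ?S"
    using sum_card_fibres[of ?S snd] by simp
  also have "\<dots> = (\<Sum>v\<in>UNIV. card {z. Q v + z * B u v = 0})"
  proof -
    have "?S = Sigma UNIV (\<lambda>v. {z. Q v + z * B u v = 0})" by auto
    then show ?thesis by simp
  qed
  also have "\<dots> = (\<Sum>v\<in>UNIV. of_bool (B u v \<noteq> 0) + CARD('k) * of_bool (Q v = 0 \<and> B u v = 0))"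
  proof (rule sum.cong[OF refl])
    fix v
    show "card {z. Q v + z * B u v = 0}
      = of_bool (B u v \<noteq> 0) + CARD('k) * of_bool (Q v = 0 \<and> B u v = 0)"
    proof (cases "B u v = 0")
      case False
      then have "{z. Q v + z * B u v = 0} = {- Q v / B u v}"
        by (auto simp: field_simps eq_neg_iff_add_eq_0)
      then show ?thesis using False by simp
    qed simp
  qed
  also have "\<dots> = card {v. B u v \<noteq> 0} + CARD('k) * card {v. Q v = 0 \<and> B u v = 0}"
    by (simp add: sum.distrib flip: sum_distrib_left)
  finally show ?thesis .
qed

text \<open>In the sum over \<open>z\<close>, an isotropic \<open>u\<close> contributes the zero
  level every time. For other \<open>u\<close>, \<open>z = 0\<close> contributes the zero level and
  every other \<open>z\<close> a nonzero level, so that equidistribution makes the total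
  \<open>CARD('v)\<close>.\<close>

lemma card_isotropic_perp:
  assumes "u \<noteq> 0"
  shows "(int CARD('k))\<^sup>2 * int (card {v. Q v = 0 \<and> B u v = 0})
    = (if Q u = 0 then (int CARD('k))\<^sup>2 * int (card {v. Q v = 0}) - (int CARD('k) - 1) * int CARD('v)
       else int CARD('v))"
proof -
  define r q M where "r = int CARD('k)" and "q = int CARD('v)"
    and "M = int (card {v. Q v = 0 \<and> B u v = 0})"
  have "card {v. B u v \<noteq> 0} = card (UNIV - {v. B u v = 0})"
    by (rule arg_cong[where f = card]) auto
  also have "\<dots> = CARD('v) - card {v. B u v = 0}"
    by (rule card_Diff_subset) auto
  finally have "int (card {v. B u v \<noteq> 0}) = q - int (card {v. B u v = 0})"
    by (simp add: q_def of_nat_diff card_mono)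
  moreover have "r * int (card {v. B u v = 0}) = q"
    using arg_cong[OF card_hyperplane[OF assms, of 0], of int] by (simp add: r_def q_def)
  ultimately have perp: "r * int (card {v. B u v \<noteq> 0}) = (r - 1) * q"
    by (simp add: right_diff_distrib left_diff_distrib)
  define L where "L = int (\<Sum>z\<in>UNIV. card {v. Q v = z\<^sup>2 * Q u})"
  have "L = int (card {v. B u v \<noteq> 0}) + r * M"
    unfolding L_def sum_levels_eq by (simp add: M_def r_def)
  then have lin: "r * L = (r - 1) * q + r\<^sup>2 * M"
    using perp by (simp add: distrib_left power2_eq_square)
  have "r\<^sup>2 * M = (if Q u = 0 then r\<^sup>2 * int (card {v. Q v = 0}) - (r - 1) * q else q)"
  proof (cases "Q u = 0")
    case True
    then have "L = r * int (card {v. Q v = 0})" by (simp add: L_def r_def)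
    then show ?thesis using lin True by (simp add: power2_eq_square)
  next
    case False
    have "card {v. Q v = z\<^sup>2 * Q u} = card {v. Q v = 1}" if "z \<noteq> 0" for z
      using that False by (intro equidistributed) simp
    from sum_const_off_zero[of "\<lambda>z. card {v. Q v = z\<^sup>2 * Q u}", OF this] have "(\<Sum>z\<in>UNIV. card {v. Q v = z\<^sup>2 * Q u})
        = card {v. Q v = 0} + (CARD('k) - 1) * card {v. Q v = 1}"
      by simp
    then have "L = q" using card_level_sum by (simp add: L_def q_def)
    then show ?thesis using lin False by (simp add: left_diff_distrib)
  qed
  then show ?thesis unfolding r_def q_def M_def .
qed

text \<open>Scaling preserves \<open>Q v = 0\<close> and permutes the nonzero values of
  \<open>B u\<close> transitively, so all sections with nonzero value have the same size.\<close>

lemma card_isotropic_section: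
  assumes "b \<noteq> 0"
  shows "card {v. Q v = 0 \<and> B u v = 0} + (CARD('k) - 1) * card {v. Q v = 0 \<and> B u v = b}
    = card {v. Q v = 0}"
proof -
  have eq: "card {v. Q v = 0 \<and> B u v = b'} = card {v. Q v = 0 \<and> B u v = b}" if "b' \<noteq> 0" for b'
    using assms that
    by (intro bij_betw_same_card[of "scale (b / b')"]
        bij_betw_byWitness[where f' = "scale (b' / b)"]) (auto simp: B_scale Q_scale)
  have "card {v. Q v = 0} = (\<Sum>b'\<in>UNIV. card {v. Q v = 0 \<and> B u v = b'})"
    using sum_card_fibres[of "{v. Q v = 0}" "B u"] by simp
  also have "\<dots> = card {v. Q v = 0 \<and> B u v = 0}
      + (CARD('k) - 1) * card {v. Q v = 0 \<and> B u v = b}"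
    by (subst sum_const_off_zero[OF eq]) auto
  finally show ?thesis by simp
qed

end

section \<open>The trace of a finite field over its prime field\<close>

lemma card_power_eq_le:
  fixes a :: "'a::idom"
  assumes "n > 0"
  shows "finite {x. x ^ n = a} \<and> card {x. x ^ n = a} \<le> n"
proof -
  define f where "f = monom 1 n - [:a:]"
  have "coeff f n = 1" using assms by (simp add: f_def coeff_pCons split: nat.split)
  then have "f \<noteq> 0" by auto
  moreover have "degree f \<le> n"
    unfolding f_def by (intro degree_diff_le) (auto simp: degree_monom_le)
  moreover have "{x. x ^ n = a} = {x. poly f x = 0}"
    by (simp add: f_def poly_monom)
  ultimately show ?thesis
    using card_poly_roots_bound[of f] poly_roots_finite[of f] by auto
qed

text \<open>The library version of the next lemma is restricted to the class \<open>finite_field\<close>, which the sort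
  \<open>{field, finite}\<close> does not imply syntactically.\<close>

lemma power_card_eq_self:
  fixes x :: "'a::{field,finite}"
  shows "x ^ CARD('a) = x"
proof (cases "x = 0")
  case False
  have "(\<Prod>y\<in>UNIV - {0}. x * y) = (\<Prod>y\<in>UNIV - {0}. y)"
    by (rule prod.reindex_bij_witness[of _ "\<lambda>y. y / x" "\<lambda>y. x * y"]) (use False in auto)
  then have "x ^ card (UNIV - {0 :: 'a}) * (\<Prod>y\<in>UNIV - {0}. y) = 1 * (\<Prod>y\<in>UNIV - {0}. y)"
    by (simp only: prod.distrib prod_constant mult_1)
  moreover have "(\<Prod>y\<in>UNIV - {0 :: 'a}. y) \<noteq> 0" by (simp only: prod_zero_iff finite) blast
  ultimately have "x ^ card (UNIV - {0 :: 'a}) = 1" by (rule mult_right_cancel[THEN iffD1, rotated])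
  moreover have "CARD('a) = Suc (card (UNIV - {0 :: 'a}))"
    by (rule card_Suc_Diff1[symmetric]) simp_all
  ultimately show ?thesis by (simp only: power_Suc mult_1_right)
qed simp

text \<open>Fibres of the \<open>k\<close>-th power map have at most \<open>k\<close> elements, so
  its image has at least \<open>l\<close>; but the image lies among the at most \<open>l\<close>
  roots of \<open>y ^ l = 1\<close>. The cyclic structure of the unit group is thereby
  avoided.\<close>

lemma power_cofactor_image:
  fixes k l :: nat
  assumes "CARD('a::{field,finite}) = k * l + 1"
  shows "(\<lambda>x :: 'a. x ^ k) ` (UNIV - {0}) = {y. y ^ l = 1} \<and> card {y :: 'a. y ^ l = 1} = l"
proof -
  let ?U = "UNIV - {0 :: 'a}" and ?I = "(\<lambda>x :: 'a. x ^ k) ` (UNIV - {0})"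
  have cU: "card ?U = k * l"
    using assms by (simp add: card_Diff_subset)
  have "(1 :: 'a) \<in> ?U" by simp
  then have "?U \<noteq> {}" by blast
  then have "card ?U > 0" unfolding card_gt_0_iff by simp
  then have pos: "k > 0" "l > 0" unfolding cU by auto
  have one: "x ^ (k * l) = 1" if "x \<noteq> 0" for x :: 'a
    using power_card_eq_self[of x] that assms by simp
  have sub: "?I \<subseteq> {y. y ^ l = 1}"
    using one by (auto simp: power_mult)
  have "card ?U = card (\<Union>y\<in>?I. {x \<in> ?U. x ^ k = y})"
    by (rule arg_cong[where f = card]) auto
  also have "\<dots> \<le> (\<Sum>y\<in>?I. card {x \<in> ?U. x ^ k = y})"
    by (rule card_UN_le) simp
  also have "\<dots> \<le> (\<Sum>y\<in>?I. k)"
  proof (rule sum_mono)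
    fix y
    have "card {x \<in> ?U. x ^ k = y} \<le> card {x. x ^ k = y}"
      by (rule card_mono) auto
    also have "\<dots> \<le> k" using card_power_eq_le pos by blast
    finally show "card {x \<in> ?U. x ^ k = y} \<le> k" .
  qed
  finally have "k * l \<le> k * card ?I" unfolding cU by (simp only: sum_constant mult.commute of_nat_id)
  then have "l \<le> card ?I" using pos(1) by (simp only: mult_le_cancel1)
  moreover have "card {y :: 'a. y ^ l = 1} \<le> l" using card_power_eq_le pos by blast
  ultimately have "?I = {y. y ^ l = 1}"
    by (intro card_seteq[OF _ sub]) (simp, rule order_trans)
  moreover from this have "card ?I = card {y :: 'a. y ^ l = 1}"
    by (rule arg_cong)
  then have "card {y :: 'a. y ^ l = 1} = l"
    using \<open>l \<le> card ?I\<close> \<open>card {y :: 'a. y ^ l = 1} \<le> l\<close> by linarith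
  ultimately show ?thesis by (rule conjI)
qed

text \<open>The roots of unity act freely on nonzero elements, so \<open>S\<close> splits into
  orbits of size exactly \<open>k\<close>.\<close>

lemma dvd_card_if_closed_under_roots_of_unity:
  fixes S :: "'a::{field,finite} set"
  assumes "card {w :: 'a. w ^ k = 1} = k" "k > 0" "0 \<notin> S"
    and "\<And>w x. w ^ k = 1 \<Longrightarrow> x \<in> S \<Longrightarrow> w * x \<in> S"
  shows "k dvd card S"
proof -
  let ?r = "{(x, y). x \<in> S \<and> y \<in> S \<and> (\<exists>w. w ^ k = 1 \<and> y = w * x)}"
  have "equiv S ?r"
  proof (rule equivI)
    show "refl_on S ?r" by (auto intro!: refl_onI exI[of _ 1])
    show "sym ?r"
    proof (rule symI, clarify)
      fix x w :: 'a assume w: "w ^ k = 1" and "x \<in> S" "w * x \<in> S"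
      have "w \<noteq> 0" using w assms(2) by (auto simp: power_0_left)
      then have "x = inverse w * (w * x)" by simp
      moreover have "inverse w ^ k = 1" using w by (simp add: power_inverse)
      ultimately show "\<exists>w'. w' ^ k = 1 \<and> x = w' * (w * x)"
        by blast
    qed
    show "trans ?r"
    proof (rule transI, clarify)
      fix x w w' :: 'a assume "w ^ k = 1" "w' ^ k = 1" "x \<in> S" "w' * (w * x) \<in> S"
      then show "\<exists>z. z ^ k = 1 \<and> w' * (w * x) = z * x"
        by (intro exI[of _ "w' * w"]) (simp_all add: power_mult_distrib)
    qed
    show "?r \<subseteq> S \<times> S" by auto
  qed
  then show ?thesis
  proof (rule equiv_imp_dvd_card[rotated])
    fix X assume "X \<in> S // ?r"
    then obtain x where x: "x \<in> S" and X: "X = ?r `` {x}" by (auto elim: quotientE)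
    have x0: "x \<noteq> 0" using x assms(3) by auto
    have "X = (\<lambda>w. w * x) ` {w. w ^ k = 1}"
      using X x assms(4) by auto
    moreover have "inj_on (\<lambda>w. w * x) {w. w ^ k = 1}" using x0 by (auto intro: inj_onI)
    ultimately show "k dvd card X" using assms(1) by (simp add: card_image)
  qed simp
qed

section \<open>The prime subfield, Frobenius powers and the absolute trace\<close>

locale prime_field_extension =
  fixes e :: nat and p_type :: "'p::prime_card itself" and b_type :: "'b::{field,finite} itself"
  assumes card_extension: "CARD('b) = CARD('p) ^ e"
begin

abbreviation emb :: "'p mod_ring \<Rightarrow> 'b" where "emb \<equiv> prime_field_embed"
abbreviation Tr :: "'b \<Rightarrow> 'p mod_ring" where "Tr \<equiv> field_trace e"

lemma char_extension: "CHAR('b) = CARD('p)"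
proof -
  have "CHAR('b) > 0" by (rule finite_imp_CHAR_pos) simp
  then have "prime CHAR('b)" by (rule prime_CHAR_semidom)
  moreover have "CHAR('b) dvd CARD('p) ^ e"
    using CHAR_dvd_CARD[where 'a = 'b] card_extension by simp
  ultimately show ?thesis
    using prime_card[where 'a = 'p] by (metis prime_dvd_power primes_dvd_imp_eq)
qed

lemma prime_char: "prime CHAR('b)"
  unfolding char_extension by (rule prime_card)

lemma degree_pos: "e > 0"
  using card_extension card_mono[of UNIV "{0, 1 :: 'b}"] by (cases e) auto

lemma frobenius_add: "(x + y :: 'b) ^ (CARD('p) ^ k) = x ^ (CARD('p) ^ k) + y ^ (CARD('p) ^ k)"
  by (rule freshmans_dream'[OF prime_char]) (simp add: char_extension)

lemma frobenius_full: "(x :: 'b) ^ (CARD('p) ^ (e * k)) = x"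
  by (induction k) (simp_all add: power_add power_mult power_card_eq_self flip: card_extension)

text \<open>Since the characteristic is \<open>CARD('p)\<close>, any integer representative may
  replace the canonical one. The homomorphism laws for \<open>emb\<close> follow from those of
  \<open>of_int\<close>.\<close>

lemma emb_of_int: "emb (of_int k) = of_int k"
proof -
  have "to_int_mod_ring (of_int k :: 'p mod_ring) = k mod int CARD('p)"
    unfolding of_int_of_int_mod_ring by transfer simp
  then show ?thesis
    unfolding prime_field_embed_def by (metis char_extension of_int_mod_CHAR)
qed

lemma of_int_to_int: "of_int (to_int_mod_ring a) = (a :: 'p mod_ring)"
  by (simp add: of_int_of_int_mod_ring)

lemma emb_add: "emb (a + b) = emb a + emb b"
  by (metis emb_of_int of_int_add of_int_to_int)

lemma emb_mult: "emb (a * b) = emb a * emb b"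
  by (metis emb_of_int of_int_mult of_int_to_int)

lemma emb_zero [simp]: "emb 0 = 0" and emb_one [simp]: "emb 1 = 1"
  using emb_of_int[of 0] emb_of_int[of 1] by simp_all

lemma emb_power: "emb (a ^ k) = emb a ^ k"
  by (induction k) (simp_all add: emb_mult)

lemma emb_eq_0_iff [simp]: "emb a = 0 \<longleftrightarrow> a = 0"
proof
  assume "emb a = 0"
  show "a = 0"
  proof (rule ccontr)
    assume "a \<noteq> 0"
    then have "emb a * emb (inverse a) = 1" by (simp flip: emb_mult)
    with \<open>emb a = 0\<close> show False by simp
  qed
qed simp

lemma emb_inj: "emb a = emb b \<longleftrightarrow> a = b"
proof -
  have "emb (a - b) + emb b = emb a" by (simp flip: emb_add)
  then show ?thesis by (metis add_cancel_left_left emb_eq_0_iff eq_iff_diff_eq_0)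
qed

lemma emb_frobenius: "emb a ^ (CARD('p) ^ k) = emb a"
proof -
  have "a ^ (CARD('p) ^ k) = a"
    by (rule finite_field_power_card_power_eq_same[where n = k]) simp
  then show ?thesis by (metis emb_power)
qed

text \<open>X^p - X has at most p roots, and the embedded prime field already supplies p of
  them.\<close>

lemma frobenius_fixed_iff: "(x :: 'b) ^ CARD('p) = x \<longleftrightarrow> x \<in> range emb"
proof -
  have p: "CARD('p) > 1" by (rule nontriv)
  define f :: "'b poly" where "f = monom 1 CARD('p) - monom 1 1"
  have "coeff f CARD('p) = 1" using p by (simp add: f_def)
  then have "f \<noteq> 0" by auto
  moreover have "degree f \<le> CARD('p)"
    unfolding f_def using p by (intro degree_diff_le) (auto intro: order.trans[OF degree_monom_le])
  moreover have roots: "{x. poly f x = 0} = {x. x ^ CARD('p) = x}"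
    by (simp add: f_def poly_monom)
  ultimately have "card {x :: 'b. x ^ CARD('p) = x} \<le> CARD('p)"
    using card_poly_roots_bound[of f] by simp
  moreover have "card (range emb) = CARD('p)"
    by (subst card_image) (auto simp: inj_on_def emb_inj)
  moreover have "range emb \<subseteq> {x. x ^ CARD('p) = x}"
    using emb_frobenius[of _ 1] by auto
  ultimately have "range emb = {x :: 'b. x ^ CARD('p) = x}"
    by (intro card_seteq) auto
  then show ?thesis by auto
qed

text \<open>Makes the definite description in \<open>field_trace\<close> usable. The Frobenius map
  shifts the conjugates cyclically, since the one with index \<open>e\<close> is \<open>x\<close>
  again; their sum is therefore fixed and lies in the prime subfield.\<close>

lemma emb_trace: "emb (Tr x) = (\<Sum>i<e. x ^ (CARD('p) ^ i))"
proof -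
  let ?s = "\<Sum>i<e. x ^ (CARD('p) ^ i)"
  have "?s ^ (CARD('p) ^ 1) = (\<Sum>i<e. (x ^ (CARD('p) ^ i)) ^ (CARD('p) ^ 1))"
    by (rule freshmans_dream_sum'[OF prime_char, where n = 1]) (simp add: char_extension)
  also have "\<dots> = (\<Sum>i<e. x ^ (CARD('p) ^ Suc i))"
    by (simp add: mult.commute flip: power_mult)
  also have "\<dots> = ?s"
  proof -
    have full: "x ^ (CARD('p) ^ e) = x" using frobenius_full[of x 1] by simp
    have "x ^ (CARD('p) ^ 0) + (\<Sum>i<e. x ^ (CARD('p) ^ Suc i)) = (\<Sum>i<Suc e. x ^ (CARD('p) ^ i))"
      by (rule sum.lessThan_Suc_shift[symmetric])
    also have "\<dots> = ?s + x"
      unfolding sum.lessThan_Suc full ..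
    finally show ?thesis
      by (simp only: power_0 power_one_right add.commute[of x "sum _ _"] add_right_cancel)
  qed
  finally have "?s \<in> range emb"
    unfolding power_one_right frobenius_fixed_iff .
  then obtain a where a: "?s = emb a" by blast
  then have "Tr x = a"
    unfolding field_trace_def a by (intro the_equality) (simp_all only: emb_inj)
  then show ?thesis by (simp only: a)
qed

lemma trace_add: "Tr (x + y) = Tr x + Tr y"
  by (simp add: emb_trace frobenius_add sum.distrib emb_add flip: emb_inj)

lemma trace_scale: "Tr (emb a * x) = a * Tr x"
  by (simp add: emb_trace emb_frobenius power_mult_distrib sum_distrib_left emb_mult flip: emb_inj)

lemma trace_zero [simp]: "Tr 0 = 0"
  using trace_scale[of 0 0] by simp

text \<open>The conjugate sum of a Frobenius image is the Frobenius image of the conjugate sum, and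
  prime field elements are fixed.\<close>

lemma trace_frobenius: "Tr (x ^ (CARD('p) ^ k)) = Tr x"
proof -
  have "(\<Sum>i<e. (x ^ (CARD('p) ^ k)) ^ (CARD('p) ^ i)) = emb (Tr x) ^ (CARD('p) ^ k)"
    unfolding emb_trace
    by (subst freshmans_dream_sum'[OF prime_char]) (simp_all add: char_extension mult.commute flip: power_mult)
  then have "emb (Tr (x ^ (CARD('p) ^ k))) = emb (Tr x)"
    by (simp only: emb_frobenius flip: emb_trace)
  then show ?thesis by (simp only: emb_inj)
qed

text \<open>Otherwise the trace polynomial, nonzero and of degree at most p^(e-1), would vanish at
  all p^e elements.\<close>

lemma trace_nontrivial: "\<exists>x :: 'b. Tr x \<noteq> 0"
proof (rule ccontr)
  assume "\<not> ?thesis"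
  then have zero: "(\<Sum>i<e. x ^ (CARD('p) ^ i)) = 0" for x :: 'b
    using emb_trace[of x] by simp
  have p: "CARD('p) > 1" by (rule nontriv)
  define f :: "'b poly" where "f = (\<Sum>i<e. monom 1 (CARD('p) ^ i))"
  \<comment> \<open>Only the summand with \<open>i = 0\<close> has degree 1, because p > 1.\<close>
  have "coeff f 1 = (\<Sum>i<e. if i = 0 then 1 else 0)"
    unfolding f_def coeff_sum using p by (intro sum.cong) auto
  then have "f \<noteq> 0" using degree_pos by auto
  moreover have "degree f \<le> CARD('p) ^ (e - 1)"
    unfolding f_def
  proof (rule degree_sum_le)
    fix i assume "i \<in> {..<e}"
    then show "degree (monom (1 :: 'b) (CARD('p) ^ i)) \<le> CARD('p) ^ (e - 1)"
      using p by (intro order.trans[OF degree_monom_le] power_increasing) auto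
  qed simp
  moreover have "{x. poly f x = 0} = UNIV"
    using zero by (simp add: f_def poly_sum poly_monom)
  ultimately have "CARD('b) \<le> CARD('p) ^ (e - 1)"
    using card_poly_roots_bound[of f] by simp
  moreover have "CARD('p) ^ (e - 1) < CARD('p) ^ e"
    using p degree_pos by (intro power_strict_increasing) auto
  ultimately show False by (simp add: card_extension)
qed

lemma trace_mult_nontrivial:
  assumes "(x :: 'b) \<noteq> 0"
  shows "\<exists>v. Tr (x * v) \<noteq> 0"
proof -
  obtain y :: 'b where "Tr y \<noteq> 0" using trace_nontrivial by blast
  then show ?thesis using assms by (intro exI[of _ "y / x"]) simp
qed

sublocale extension_space: vector_space "\<lambda>a x. emb a * x"
  by unfold_locales (simp_all add: emb_add emb_mult algebra_simps)

end

section \<open>The trace form\<close>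

text \<open>\<open>x\<close> is congruent to -1 modulo \<open>x + 1\<close>, and an odd power of -1
  is -1.\<close>

lemma Suc_dvd_odd_power_Suc:
  fixes x :: nat
  assumes "odd s"
  shows "x + 1 dvd x ^ s + 1"
proof -
  have "[int x = - 1] (mod (int x + 1))" by (simp add: cong_iff_dvd_diff)
  then have "[int x ^ s = (- 1) ^ s] (mod (int x + 1))" by (rule cong_pow)
  then have "int x + 1 dvd int x ^ s + 1" using assms by (simp add: cong_iff_dvd_diff)
  then have "int (x + 1) dvd int (x ^ s + 1)" by (simp add: add.commute)
  then show ?thesis by (simp only: of_nat_dvd_iff)
qed

lemma pred_dvd_power_pred:
  fixes x :: nat
  assumes "x \<ge> 1"
  shows "x - 1 dvd x ^ n - 1"
proof -
  have "int x - 1 dvd int x ^ n - 1" by (simp add: power_diff_1_eq)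
  then have "int (x - 1) dvd int (x ^ n - 1)" using assms by (simp add: of_nat_diff)
  then show ?thesis by (simp only: of_nat_dvd_iff)
qed

text \<open>On \<open>nat\<close>, \<open>m div d\<close> rounds down, so \<open>d dvd m\<close>
  expresses that the quotient m/d is an integer.\<close>

locale odd_trace_form = prime_field_extension e p_type b_type
  for e :: nat and p_type :: "'p::prime_card itself" and b_type :: "'b::{field,finite} itself" +
  fixes m \<alpha> d :: nat
  assumes odd_p: "odd CARD('p)" and m_pos: "m > 0" and e_eq: "e = 2 * m"
    and d_eq: "d = gcd \<alpha> e" and d_dvd: "d dvd m" and odd_m_d: "odd (m div d)"
begin

definition Q :: "'b \<Rightarrow> 'p mod_ring" where
  "Q v = Tr (v ^ (CARD('p) ^ \<alpha> + 1))"

text \<open>The exponent \<open>\<alpha> * (e - 1)\<close> inverts the automorphism \<open>x \<mapsto> x^(p^\<alpha>)\<close>, so that the trace form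
  \<open>Tr (L u * v)\<close> below is the polar form of \<open>Q\<close>.\<close>

definition L :: "'b \<Rightarrow> 'b" where
  "L u = u ^ (CARD('p) ^ \<alpha>) + u ^ (CARD('p) ^ (\<alpha> * (e - 1)))"

text \<open>Dividing \<open>gcd \<alpha> e = d\<close> by \<open>d\<close> shows that \<alpha>/d is
  coprime to 2m/d, an even number.\<close>

lemma odd_alpha_d: obtains s where "\<alpha> = d * s" "odd s"
proof -
  have "d > 0" using d_dvd m_pos by (metis dvd_0_left_iff gr0I)
  obtain s where s: "\<alpha> = d * s" using d_eq by (metis gcd_dvd1 dvdE)
  obtain t where t: "m = d * t" using d_dvd by auto
  have "gcd (d * s) (2 * (d * t)) = d * gcd s (2 * t)"
    by (metis gcd_mult_distrib_nat mult.left_commute)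
  then have "d * gcd s (2 * t) = d * 1"
    using d_eq e_eq s t by (metis mult_1_right)
  then have "gcd s (2 * t) = 1" using \<open>d > 0\<close> by (metis mult_left_cancel neq0_conv)
  then have "coprime s (2 * t)" by (simp only: coprime_iff_gcd_eq_1)
  then have "odd s" by auto
  with s show ?thesis by (rule that)
qed

lemma unit_order_dvd: "CARD('p) ^ d + 1 dvd CARD('p) ^ \<alpha> + 1" "CARD('p) ^ d + 1 dvd CARD('p) ^ m + 1"
proof -
  obtain s where s: "\<alpha> = d * s" "odd s" by (rule odd_alpha_d)
  then show "CARD('p) ^ d + 1 dvd CARD('p) ^ \<alpha> + 1"
    using Suc_dvd_odd_power_Suc[of s "CARD('p) ^ d"] by (simp add: power_mult)
  have "(CARD('p) ^ d) ^ (m div d) = CARD('p) ^ m" using d_dvd by (simp flip: power_mult)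
  then show "CARD('p) ^ d + 1 dvd CARD('p) ^ m + 1"
    using Suc_dvd_odd_power_Suc[OF odd_m_d, of "CARD('p) ^ d"] by simp
qed

lemma p_gt_2: "CARD('p) > 2"
  using odd_p nontriv[where 'a = 'p] by (cases "CARD('p) = 2") auto

lemma two_nonzero_ext: "(2 :: 'b) \<noteq> 0" and two_nonzero_base: "(2 :: 'p mod_ring) \<noteq> 0"
proof -
  have "\<not> CARD('p) dvd 2" using p_gt_2 by (auto dest: dvd_imp_le)
  then show "(2 :: 'b) \<noteq> 0" "(2 :: 'p mod_ring) \<noteq> 0"
    using of_nat_eq_0_iff_char_dvd[of 2, where 'a = 'b]
      of_nat_eq_0_iff_char_dvd[of 2, where 'a = "'p mod_ring"]
    by (simp_all add: char_extension)
qed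

text \<open>q - 1 = (p^m + 1)(p^m - 1), where p^d + 1 divides the first factor and p - 1 the second.
  Hence the image of the power map with exponent p^d + 1 contains all (p - 1)-th roots of
  unity.\<close>

lemma card_factorization:
  obtains l where "CARD('b) = (CARD('p) ^ d + 1) * ((CARD('p) - 1) * l) + 1"
proof -
  obtain a where a: "CARD('p) ^ m + 1 = (CARD('p) ^ d + 1) * a"
    using unit_order_dvd(2) by (elim dvdE)
  have p: "CARD('p) \<ge> 1" using p_gt_2 by simp
  have "CARD('p) - 1 dvd CARD('p) ^ m - 1"
    using p by (rule pred_dvd_power_pred)
  then obtain b where b: "CARD('p) ^ m - 1 = (CARD('p) - 1) * b" by (elim dvdE)
  have "CARD('p) ^ m \<ge> 1" using p by simp
  then have "CARD('b) = (CARD('p) ^ m + 1) * (CARD('p) ^ m - 1) + 1"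
    unfolding card_extension e_eq mult_2 power_add
    by (simp add: algebra_simps diff_mult_distrib2)
  also have "\<dots> = (CARD('p) ^ d + 1) * ((CARD('p) - 1) * (a * b)) + 1"
    unfolding a b by (simp add: algebra_simps)
  finally show ?thesis by (rule that)
qed

text \<open>Choose \<open>z\<close> with z^(p^d + 1) = a. Then z^(p^d) = a/z, and a second
  application returns \<open>z\<close>. As \<alpha> is an odd multiple of \<open>d\<close>,
  z^(p^\<alpha> + 1) equals \<open>a\<close> too, and \<open>a\<close> comes out of the
  trace.\<close>

lemma similitude:
  assumes "a \<noteq> 0"
  obtains z where "z \<noteq> 0" "\<And>v. Q (z * v) = a * Q v"
proof -
  obtain l where "CARD('b) = (CARD('p) ^ d + 1) * ((CARD('p) - 1) * l) + 1"
    by (rule card_factorization)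
  note image = power_cofactor_image[OF this]
  \<comment> \<open>Units of the prime field are (p - 1)-th roots of unity, hence in the image of
    the power map.\<close>
  have "emb a * emb a ^ (CARD('p) - 1) = emb a * 1"
    using emb_frobenius[of a 1] p_gt_2 by (simp flip: power_Suc)
  then have "emb a ^ (CARD('p) - 1) = 1" using assms by simp
  then have "emb a \<in> {y. y ^ ((CARD('p) - 1) * l) = 1}" by (simp add: power_mult)
  then obtain z where z0: "z \<noteq> 0" and z: "z ^ (CARD('p) ^ d + 1) = emb a"
    using image by (metis (no_types, lifting) DiffE image_iff insertCI)
  have zd: "z ^ (CARD('p) ^ d) = emb a / z"
    using z z0 by (simp add: field_simps)
  have "z ^ (CARD('p) ^ (d + d)) = (z ^ (CARD('p) ^ d)) ^ (CARD('p) ^ d)"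
    by (simp only: power_add power_mult)
  also have "\<dots> = z"
    unfolding zd power_divide emb_frobenius using assms z0 by (simp add: zd)
  finally have z2: "z ^ (CARD('p) ^ (d + d)) = z" .
  have z2j: "z ^ (CARD('p) ^ ((d + d) * j)) = z" for j
    by (induction j) (simp_all add: power_add[of _ "d + d"] power_mult z2)
  obtain s where s: "\<alpha> = d * s" "odd s" by (rule odd_alpha_d)
  then obtain j where "s = 2 * j + 1" by (elim oddE)
  then have "\<alpha> = (d + d) * j + d" using s by (simp add: algebra_simps)
  then have "z ^ (CARD('p) ^ \<alpha>) = (z ^ (CARD('p) ^ ((d + d) * j))) ^ (CARD('p) ^ d)"
    by (simp only: power_add power_mult)
  then have "z ^ (CARD('p) ^ \<alpha>) = z ^ (CARD('p) ^ d)" by (simp only: z2j)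
  then have "z ^ (CARD('p) ^ \<alpha> + 1) = emb a" using z by simp
  then have "Q (z * v) = a * Q v" for v
    unfolding Q_def by (simp only: power_mult_distrib trace_scale)
  with z0 show ?thesis by (rule that)
qed

section \<open>The trace form as a nondegenerate quadratic form\<close>

lemma frobenius_inverse: "(v ^ (CARD('p) ^ (\<alpha> * (e - 1)))) ^ (CARD('p) ^ \<alpha>) = (v :: 'b)"
proof -
  have "\<alpha> * (e - 1) + \<alpha> = e * \<alpha>"
    using degree_pos by (cases e) simp_all
  then show ?thesis
    by (simp add: frobenius_full flip: power_mult power_add)
qed

text \<open>Of the two mixed terms in the expansion, one carries the Frobenius power on
  \<open>v\<close>. Invariance of the trace under the inverse power moves it to
  \<open>u\<close>.\<close>

lemma Q_add: "Q (u + v) = Q u + Q v + Tr (L u * v)"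
proof -
  have inv: "(v ^ (CARD('p) ^ \<alpha>)) ^ (CARD('p) ^ (\<alpha> * (e - 1))) = v"
    using frobenius_inverse[of v] by (metis power_mult mult.commute)
  have "Tr (v ^ (CARD('p) ^ \<alpha>) * u) = Tr ((v ^ (CARD('p) ^ \<alpha>) * u) ^ (CARD('p) ^ (\<alpha> * (e - 1))))"
    by (rule trace_frobenius[symmetric])
  also have "\<dots> = Tr (u ^ (CARD('p) ^ (\<alpha> * (e - 1))) * v)"
    unfolding power_mult_distrib inv by (rule arg_cong[where f = Tr]) (rule mult.commute)
  finally have twist: "Tr (v ^ (CARD('p) ^ \<alpha>) * u) = Tr (u ^ (CARD('p) ^ (\<alpha> * (e - 1))) * v)" .
  have "(u + v) ^ (CARD('p) ^ \<alpha> + 1) = u ^ (CARD('p) ^ \<alpha> + 1) + v ^ (CARD('p) ^ \<alpha> + 1)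
      + (u ^ (CARD('p) ^ \<alpha>) * v + v ^ (CARD('p) ^ \<alpha>) * u)"
    unfolding power_add power_one_right frobenius_add by (simp only: distrib_left distrib_right add_ac)
  then show ?thesis
    unfolding Q_def L_def distrib_right by (simp only: trace_add twist)
qed

lemma L_add: "L (u + v) = L u + L v"
  by (simp add: L_def frobenius_add)

lemma L_eq_0D:
  assumes "L u = 0"
  shows "u = 0"
proof -
  have "L u ^ (CARD('p) ^ \<alpha>) = 0" using assms by simp
  then have "u ^ (CARD('p) ^ (\<alpha> + \<alpha>)) + u = 0"
    by (simp only: L_def frobenius_add frobenius_inverse power_add[of "CARD('p)"] power_mult[of u])
  then have twist: "u ^ (CARD('p) ^ (\<alpha> + \<alpha>)) = - u" by (simp add: eq_neg_iff_add_eq_0)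
  have odd_pow: "(- 1 :: 'b) ^ (CARD('p) ^ k) = - 1" for k using odd_p by simp
  have "u ^ (CARD('p) ^ ((\<alpha> + \<alpha>) * k)) = (- 1) ^ k * u" for k
  proof (induction k)
    case (Suc k)
    have "u ^ (CARD('p) ^ ((\<alpha> + \<alpha>) * Suc k)) = (u ^ (CARD('p) ^ (\<alpha> + \<alpha>))) ^ (CARD('p) ^ ((\<alpha> + \<alpha>) * k))"
      by (simp add: power_add power_mult)
    also have "\<dots> = - (u ^ (CARD('p) ^ ((\<alpha> + \<alpha>) * k)))"
      unfolding twist using odd_p by (simp add: power_minus_odd)
    finally show ?case using Suc by simp
  qed simp
  from this[of "m div d"] have "u ^ (CARD('p) ^ ((\<alpha> + \<alpha>) * (m div d))) = - u"
    using odd_m_d by simp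
  \<comment> \<open>The total exponent is a multiple of \<open>e\<close>, so the iterated power map
    is the identity.\<close>
  moreover have "(\<alpha> + \<alpha>) * (m div d) = e * (\<alpha> div d)"
  proof -
    have "d dvd \<alpha>" by (simp add: d_eq)
    then show ?thesis using d_dvd by (auto simp: e_eq elim!: dvdE)
  qed
  ultimately have "u = - u" using frobenius_full[of u "\<alpha> div d"] by simp
  then have "2 * u = 0" by (metis add_eq_0_iff2 mult_2)
  then show ?thesis using two_nonzero_ext by simp
qed

lemma inj_L: "inj L"
proof (rule injI)
  fix u v assume "L u = L v"
  then have "L (u - v) = 0" using L_add[of "u - v" v] by simp
  then show "u = v" using L_eq_0D by force
qed

lemma bij_L: "bij L"
  using inj_L by (simp add: bij_def finite_UNIV_inj_surj)

lemma L_zero [simp]: "L 0 = 0"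
  by (metis L_add add_cancel_right_left)

lemma L_eq_0_iff [simp]: "L u = 0 \<longleftrightarrow> u = 0"
  using L_eq_0D by auto

sublocale form: finite_quadratic_space "\<lambda>a x. emb a * x" Q "\<lambda>u v. Tr (L u * v)"
proof unfold_locales
  fix a :: "'p mod_ring" and u v w :: 'b
  show "Q (u + v) = Q u + Q v + Tr (L u * v)" by (rule Q_add)
  show "Q (emb a * v) = a\<^sup>2 * Q v"
  proof -
    have "(emb a * v) ^ (CARD('p) ^ \<alpha> + 1) = emb a * (emb a * v ^ (CARD('p) ^ \<alpha> + 1))"
      by (simp add: power_mult_distrib emb_frobenius mult_ac)
    then show ?thesis by (simp only: Q_def trace_scale power2_eq_square mult.assoc)
  qed
  show "Tr (L u * (v + w)) = Tr (L u * v) + Tr (L u * w)"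
    by (simp add: distrib_left trace_add)
  show "Tr (L u * (emb a * v)) = a * Tr (L u * v)"
    by (simp add: mult.left_commute trace_scale)
  show "\<exists>v. Tr (L u * v) \<noteq> 0" if "u \<noteq> 0"
    using that by (intro trace_mult_nontrivial) simp
  show "(2 :: 'p mod_ring) \<noteq> 0" by (rule two_nonzero_base)
  show "card {v. Q v = a} = card {v. Q v = 1}" if "a \<noteq> 0"
  proof -
    obtain z where z: "z \<noteq> 0" "\<And>v. Q (z * v) = a * Q v" using \<open>a \<noteq> 0\<close> by (rule similitude) blast
    have "Q (v / z) = Q v / a" for v
      using z(2)[of "v / z"] z(1) \<open>a \<noteq> 0\<close> by simp
    then have "bij_betw (\<lambda>v. v / z) {v. Q v = a} {v. Q v = 1}"
      using z \<open>a \<noteq> 0\<close> by (intro bij_betw_byWitness[where f' = "\<lambda>v. z * v"]) auto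
    then show ?thesis by (rule bij_betw_same_card)
  qed
qed

text \<open>Because p^d + 1 divides p^\<alpha> + 1, multiplication by a root of unity of order
  dividing p^d + 1 leaves \<open>Q\<close> unchanged.\<close>

lemma unit_order_dvd_level: "CARD('p) ^ d + 1 dvd card {v. Q v = 1}"
proof (rule dvd_card_if_closed_under_roots_of_unity)
  obtain l where "CARD('b) = (CARD('p) ^ d + 1) * ((CARD('p) - 1) * l) + 1"
    by (rule card_factorization)
  then show "card {w :: 'b. w ^ (CARD('p) ^ d + 1) = 1} = CARD('p) ^ d + 1"
    using power_cofactor_image[of "(CARD('p) - 1) * l" "CARD('p) ^ d + 1", where 'a = 'b]
    by (simp only: mult.commute)
  fix w x :: 'b
  assume w: "w ^ (CARD('p) ^ d + 1) = 1" and x: "x \<in> {v. Q v = 1}"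
  have "w ^ (CARD('p) ^ \<alpha> + 1) = 1"
    using unit_order_dvd(1) w by (metis dvdE power_mult power_one)
  then show "w * x \<in> {v. Q v = 1}"
    using x by (simp add: Q_def power_mult_distrib del: power_Suc)
qed (simp_all add: form.Q_zero)

text \<open>The sign of the square root is decided modulo \<open>p^d + 1\<close>, where \<open>p^m\<close> is congruent to \<open>- 1\<close>.\<close>

lemma card_level_one:
  "int (card {v. Q v = 1}) = int CARD('p) * (int CARD('p) ^ (m - 1))\<^sup>2 + int CARD('p) ^ (m - 1)"
proof -
  define P X N where "P = int CARD('p)" and "X = P ^ (m - 1)" and "N = int (card {v. Q v = 1})"
  have P: "P > 2" using p_gt_2 by (simp add: P_def)
  have Xm: "P ^ m = P * X" using m_pos by (simp add: X_def flip: power_Suc)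
  have q: "int CARD('b) = (P * X)\<^sup>2"
    unfolding Xm[symmetric] card_extension e_eq by (simp add: P_def mult.commute flip: power_mult)
  have "((P * X)\<^sup>2 - P * N)\<^sup>2 = (P * X)\<^sup>2"
    using form.level_deviation_square unfolding q by (simp add: P_def N_def)
  then have "P * N = (P * X)\<^sup>2 - P * X \<or> P * N = (P * X)\<^sup>2 + P * X"
    by (auto simp: power2_eq_iff)
  moreover have "P * N \<noteq> (P * X)\<^sup>2 - P * X"
  proof
    assume *: "P * N = (P * X)\<^sup>2 - P * X"
    define k where "k = P ^ d + 1"
    have "int (CARD('p) ^ d + 1) dvd int (card {v. Q v = 1})"
      by (simp only: of_nat_dvd_iff unit_order_dvd_level)
    then have "k dvd P * N" by (simp add: k_def P_def N_def add.commute)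
    moreover have "int (CARD('p) ^ d + 1) dvd int (CARD('p) ^ m + 1)"
      by (simp only: of_nat_dvd_iff unit_order_dvd)
    then have "k dvd P ^ m + 1" by (simp add: k_def P_def add.commute)
    then have "k dvd P * X + 1" by (simp only: Xm)
    \<comment> \<open>The factor \<open>P * X - 2\<close> is chosen so that the product differs from
      \<open>P * N\<close> by exactly 2; then p^d + 1 would divide 2.\<close>
    then have "k dvd (P * X + 1) * (P * X - 2)" by simp
    ultimately have "k dvd P * N - (P * X + 1) * (P * X - 2)" by (rule dvd_diff)
    also have "P * N - (P * X + 1) * (P * X - 2) = 2"
      unfolding * by (simp add: power2_eq_square algebra_simps)
    finally have "k \<le> 2" by (rule zdvd_imp_le) simp
    moreover have "d > 0" using d_dvd m_pos by (metis dvd_0_left_iff gr0I)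
    then have "P ^ d \<ge> P" using P by (intro self_le_power) auto
    ultimately show False using P by (simp add: k_def)
  qed
  ultimately have "P * N = P * (P * X\<^sup>2 + X)" by (simp add: power2_eq_square algebra_simps)
  then show ?thesis using P unfolding N_def X_def P_def by simp
qed

lemma card_level_zero:
  "int (card {v. Q v = 0})
    = int CARD('p) * (int CARD('p) ^ (m - 1))\<^sup>2 - (int CARD('p) - 1) * int CARD('p) ^ (m - 1)"
proof -
  define P X where "P = int CARD('p)" and "X = P ^ (m - 1)"
  have Xm: "P ^ m = P * X" using m_pos by (simp add: X_def flip: power_Suc)
  have q: "int CARD('b) = (P * X)\<^sup>2"
    unfolding Xm[symmetric] card_extension e_eq by (simp add: P_def mult.commute flip: power_mult)
  have "int (card {v. Q v = 0}) + (P - 1) * (P * X\<^sup>2 + X) = (P * X)\<^sup>2"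
    using arg_cong[OF form.card_level_sum, of int] card_level_one p_gt_2
    unfolding q[symmetric] by (simp add: P_def X_def of_nat_diff)
  then show ?thesis
    unfolding P_def[symmetric] X_def[symmetric] by (simp add: power2_eq_square algebra_simps)
qed

text \<open>The case \<open>b = 0\<close> is the count of isotropic vectors orthogonal to
  \<open>u\<close>; the remaining isotropic vectors are shared equally by the p - 1 nonzero
  values.\<close>

lemma card_section:
  assumes "u \<noteq> 0"
  shows "int (card {v. Q v = 0 \<and> Tr (L u * v) = b}) =
    (if b = 0
     then (int CARD('p) ^ (m - 1))\<^sup>2
       - (if Q u = 0 then (int CARD('p) - 1) * int CARD('p) ^ (m - 1) else 0)
     else (int CARD('p) ^ (m - 1))\<^sup>2 - (if Q u = 0 then 0 else int CARD('p) ^ (m - 1)))"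
proof -
  define P X where "P = int CARD('p)" and "X = P ^ (m - 1)"
  define M where "M b = int (card {v. Q v = 0 \<and> Tr (L u * v) = b})" for b
  have P: "P > 2" using p_gt_2 by (simp add: P_def)
  have Xm: "P ^ m = P * X" using m_pos by (simp add: X_def flip: power_Suc)
  have q: "int CARD('b) = P\<^sup>2 * X\<^sup>2"
    unfolding power_mult_distrib[symmetric] Xm[symmetric] card_extension e_eq
    by (simp add: P_def mult.commute flip: power_mult)
  have N0: "int (card {v. Q v = 0}) = P * X\<^sup>2 - (P - 1) * X"
    using card_level_zero by (simp add: P_def X_def)
  have "P\<^sup>2 * M 0 = (if Q u = 0 then P\<^sup>2 * (P * X\<^sup>2 - (P - 1) * X) - (P - 1) * (P\<^sup>2 * X\<^sup>2)
      else P\<^sup>2 * X\<^sup>2)"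
    using form.card_isotropic_perp[OF assms] unfolding N0 q by (simp add: M_def P_def)
  also have "\<dots> = P\<^sup>2 * (X\<^sup>2 - (if Q u = 0 then (P - 1) * X else 0))"
    by (simp add: algebra_simps)
  finally have "P\<^sup>2 * M 0 = P\<^sup>2 * (X\<^sup>2 - (if Q u = 0 then (P - 1) * X else 0))" .
  then have M0: "M 0 = X\<^sup>2 - (if Q u = 0 then (P - 1) * X else 0)" using P by simp
  have "M b = X\<^sup>2 - (if Q u = 0 then 0 else X)" if "b \<noteq> 0"
  proof -
    have "M 0 + (P - 1) * M b = P * X\<^sup>2 - (P - 1) * X"
      using arg_cong[OF form.card_isotropic_section[OF that, of u], of int] p_gt_2
      unfolding N0[symmetric] by (simp add: M_def P_def of_nat_diff)
    then have "(P - 1) * M b = P * X\<^sup>2 - (P - 1) * X - X\<^sup>2 + (if Q u = 0 then (P - 1) * X else 0)"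
      unfolding M0 by simp
    also have "\<dots> = (P - 1) * (X\<^sup>2 - (if Q u = 0 then 0 else X))"
      by (simp add: algebra_simps)
    finally have "(P - 1) * M b = (P - 1) * (X\<^sup>2 - (if Q u = 0 then 0 else X))" .
    then show ?thesis using P by simp
  qed
  then show ?thesis
    using M0 unfolding M_def P_def X_def by simp
qed

end

section \<open>The code\<close>

text \<open>With \<open>X\<close> equal to p^(m-1), the powers p^(e-1) and p^(e-2) are
  \<open>P * X\<^sup>2\<close> and \<open>X\<^sup>2\<close>, so all parameters become polynomials in
  \<open>P\<close> and \<open>X\<close>.\<close>

locale trace_form_code = odd_trace_form e p_type b_type m \<alpha> d
  for e :: nat and p_type :: "'p::prime_card itself" and b_type :: "'b::{field,finite} itself"
    and m \<alpha> d :: nat +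
  fixes c :: "'p mod_ring" and ds :: "'n::finite \<Rightarrow> 'b" and P X :: nat
  assumes P_def: "P = CARD('p)" and X_def: "X = P ^ (m - 1)"
    and c_nonzero: "c \<noteq> 0"
    and bij_ds: "bij_betw ds UNIV (defining_set TYPE('p) e \<alpha>)"
begin

text \<open>Codewords are indexed by \<open>u\<close> with \<open>x = L u\<close>, so that \<open>Tr (x v)\<close> is the polar form of \<open>Q\<close>
  at \<open>(u, v)\<close> and the type of the word is read off \<open>Q u\<close>.\<close>

definition word :: "'b \<Rightarrow> 'p mod_ring \<Rightarrow> 'p mod_ring ^ 'n" where
  "word u b = (\<chi> j. Tr (L u * ds j) + b)"

definition isotropic :: "'b set" where "isotropic = {u. u \<noteq> 0 \<and> Q u = 0}"
definition anisotropic :: "'b set" where "anisotropic = {u. Q u \<noteq> 0}"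

section \<open>Length of the code and symbol counts of its words\<close>

lemma range_ds: "range ds = {v. v \<noteq> 0 \<and> Q v = 0}"
  using bij_ds by (simp add: bij_betw_def defining_set_def Q_def)

lemma card_coordinates: "card {j. R (ds j)} = card {v. v \<noteq> 0 \<and> Q v = 0 \<and> R v}"
proof -
  have "ds ` {j. R (ds j)} = {v \<in> range ds. R v}" by auto
  also have "\<dots> = {v. v \<noteq> 0 \<and> Q v = 0 \<and> R v}" by (simp add: range_ds)
  finally have "card (ds ` {j. R (ds j)}) = card {v. v \<noteq> 0 \<and> Q v = 0 \<and> R v}"
    by (rule arg_cong)
  moreover have "inj_on ds {j. R (ds j)}"
    using bij_ds by (auto simp: bij_betw_def intro: inj_on_subset)
  ultimately show ?thesis by (simp only: card_image)
qed

lemma card_isotropic: "card isotropic + 1 = card {v. Q v = 0}"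
proof -
  have "card {v. Q v = 0} = card (insert 0 isotropic)"
    by (rule arg_cong[where f = card]) (auto simp: isotropic_def form.Q_zero)
  also have "\<dots> = card isotropic + 1"
    by (subst card_insert_disjoint) (auto simp: isotropic_def)
  finally show ?thesis by (rule sym)
qed

lemma card_index: "CARD('n) = card isotropic"
  using card_coordinates[of "\<lambda>_. True"] by (simp add: isotropic_def)

lemma P_gt_2: "P > 2"
  unfolding P_def by (rule p_gt_2)

lemma int_X: "int CARD('p) ^ (m - 1) = int X"
  by (simp add: X_def P_def)

lemmas card_level_one_X = card_level_one[unfolded int_X, folded P_def]
  and card_level_zero_X = card_level_zero[unfolded int_X, folded P_def]
  and card_section_X = card_section[unfolded int_X, folded P_def]

text \<open>Here and below, subtracted terms are moved to the other side, so that truncated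
  subtraction on \<open>nat\<close> cannot interfere.\<close>

lemma length_eq: "CARD('n) + (P - 1) * X + 1 = P * X\<^sup>2"
proof -
  have "int (CARD('n) + 1) = int P * (int X)\<^sup>2 - (int P - 1) * int X"
    using card_level_zero_X unfolding card_index card_isotropic by simp
  then have "int (CARD('n) + (P - 1) * X + 1) = int (P * X\<^sup>2)"
    using P_gt_2 by (simp add: of_nat_diff)
  then show ?thesis by (simp only: of_nat_eq_iff)
qed

text \<open>For \<open>X = 1\<close> the length would be P - (P - 1) - 1 = 0, but the coordinate
  type is nonempty.\<close>

lemma X_gt_1: "X > 1"
proof (rule ccontr)
  assume "\<not> X > 1"
  moreover have "X > 0" using P_gt_2 unfolding X_def by simp
  ultimately have X: "X = 1" by linarith
  have "CARD('n) > 0" by simp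
  then show False
    using length_eq P_gt_2 unfolding X power_one mult_1_right by linarith
qed

lemma X_less_square: "X < X\<^sup>2"
  using X_gt_1 by (simp add: power2_eq_square)

text \<open>The summand 1 accounts for the zero vector, which lies in the section with value 0 but
  is not a coordinate.\<close>

lemma card_isotropic_word:
  assumes "u \<in> isotropic"
  shows "card {j. Tr (L u * ds j) = 0} + (P - 1) * X + 1 = X\<^sup>2"
    and "b \<noteq> 0 \<Longrightarrow> card {j. Tr (L u * ds j) = b} = X\<^sup>2"
proof -
  have u: "u \<noteq> 0" "Q u = 0" using assms by (auto simp: isotropic_def)
  have "{v. Q v = 0 \<and> Tr (L u * v) = 0} = insert 0 {v. v \<noteq> 0 \<and> Q v = 0 \<and> Tr (L u * v) = 0}"
    by (auto simp: form.Q_zero)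
  then have "card {v. Q v = 0 \<and> Tr (L u * v) = 0} = card {j. Tr (L u * ds j) = 0} + 1"
    by (simp add: card_coordinates[of "\<lambda>v. Tr (L u * v) = 0"])
  then have "int (card {j. Tr (L u * ds j) = 0} + (P - 1) * X + 1) = int (X\<^sup>2)"
    using card_section_X[OF u(1), of 0] u(2) P_gt_2 by (simp add: of_nat_diff)
  then show "card {j. Tr (L u * ds j) = 0} + (P - 1) * X + 1 = X\<^sup>2"
    by (simp only: of_nat_eq_iff)
  show "card {j. Tr (L u * ds j) = b} = X\<^sup>2" if "b \<noteq> 0"
  proof -
    have "{v. v \<noteq> 0 \<and> Q v = 0 \<and> Tr (L u * v) = b} = {v. Q v = 0 \<and> Tr (L u * v) = b}"
      using that by auto
    then have "int (card {j. Tr (L u * ds j) = b}) = int (X\<^sup>2)"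
      using card_section_X[OF u(1), of b] u(2) that
      by (simp add: card_coordinates[of "\<lambda>v. Tr (L u * v) = b"])
    then show ?thesis by (simp only: of_nat_eq_iff)
  qed
qed

lemma card_anisotropic_word:
  assumes "u \<in> anisotropic"
  shows "card {j. Tr (L u * ds j) = 0} + 1 = X\<^sup>2"
    and "b \<noteq> 0 \<Longrightarrow> card {j. Tr (L u * ds j) = b} + X = X\<^sup>2"
proof -
  have u: "u \<noteq> 0" "Q u \<noteq> 0" using assms by (auto simp: anisotropic_def form.Q_zero)
  have "{v. Q v = 0 \<and> Tr (L u * v) = 0} = insert 0 {v. v \<noteq> 0 \<and> Q v = 0 \<and> Tr (L u * v) = 0}"
    by (auto simp: form.Q_zero)
  then have "card {v. Q v = 0 \<and> Tr (L u * v) = 0} = card {j. Tr (L u * ds j) = 0} + 1"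
    by (simp add: card_coordinates[of "\<lambda>v. Tr (L u * v) = 0"])
  then have "int (card {j. Tr (L u * ds j) = 0} + 1) = int (X\<^sup>2)"
    using card_section_X[OF u(1), of 0] u(2) by simp
  then show "card {j. Tr (L u * ds j) = 0} + 1 = X\<^sup>2"
    by (simp only: of_nat_eq_iff)
  show "card {j. Tr (L u * ds j) = b} + X = X\<^sup>2" if "b \<noteq> 0"
  proof -
    have "{v. v \<noteq> 0 \<and> Q v = 0 \<and> Tr (L u * v) = b} = {v. Q v = 0 \<and> Tr (L u * v) = b}"
      using that by auto
    then have "int (card {j. Tr (L u * ds j) = b} + X) = int (X\<^sup>2)"
      using card_section_X[OF u(1), of b] u(2) that
      by (simp add: card_coordinates[of "\<lambda>v. Tr (L u * v) = b"])
    then show ?thesis by (simp only: of_nat_eq_iff)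
  qed
qed

lemma nonzero_cases: "u \<noteq> 0 \<Longrightarrow> u \<in> isotropic \<or> u \<in> anisotropic"
  by (auto simp: isotropic_def anisotropic_def)

text \<open>The counts for nonzero \<open>b\<close> are \<open>X\<^sup>2\<close> or
  \<open>X\<^sup>2 - X\<close>, both positive since \<open>X > 1\<close>.\<close>

lemma value_attained:
  assumes "u \<noteq> 0" "b \<noteq> 0"
  obtains j where "Tr (L u * ds j) = b"
proof -
  have "card {j. Tr (L u * ds j) = b} > 0"
    using nonzero_cases[OF assms(1)]
  proof
    assume "u \<in> isotropic"
    then show ?thesis using card_isotropic_word(2)[OF _ assms(2), of u] X_less_square by linarith
  next
    assume "u \<in> anisotropic"
    then show ?thesis using card_anisotropic_word(2)[OF _ assms(2), of u] X_less_square by linarith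
  qed
  then have "{j. Tr (L u * ds j) = b} \<noteq> {}" by (metis card.empty less_irrefl)
  then show ?thesis using that by blast
qed

section \<open>Linearity, span and dimension\<close>

lemma trace_add_left: "Tr (L (u + u') * v) = Tr (L u * v) + Tr (L u' * v)"
  by (simp add: L_add distrib_right trace_add)

lemma word_add: "word (u + u') (b + b') = word u b + word u' b'"
  by (simp add: word_def vec_eq_iff trace_add_left)

text \<open>For nonzero \<open>u\<close> the trace part takes the distinct values 1 and 2, so no
  constant cancels it.\<close>

lemma word_eq_0_iff: "word u b = 0 \<longleftrightarrow> u = 0 \<and> b = 0"
proof
  assume "word u b = 0"
  then have w: "Tr (L u * ds j) + b = 0" for j by (simp add: word_def vec_eq_iff)
  have "u = 0"
  proof (rule ccontr)
    assume "u \<noteq> 0"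
    then obtain j j' where "Tr (L u * ds j) = 1" "Tr (L u * ds j') = 2"
      using value_attained two_nonzero_base one_neq_zero by metis
    then have "1 + b = 2 + b" using w[of j] w[of j'] by simp
    then have "(1 :: 'p mod_ring) + 0 = 1 + 1"
      by (simp only: add_right_cancel one_add_one add_0_right)
    then show False by (simp only: add_left_cancel zero_neq_one)
  qed
  then show "u = 0 \<and> b = 0" using w by simp
qed (simp add: word_def vec_eq_iff)

lemma inj_word: "inj (\<lambda>(u, b). word u b)"
proof (rule injI, clarify)
  fix u b u' b' assume "word u b = word u' b'"
  then have "word (u - u') (b - b') = 0"
    using word_add[of "u - u'" u' "b - b'" b'] by simp
  then show "u = u' \<and> b = b'" by (simp add: word_eq_0_iff)
qed

lemma inj_word_c: "inj (\<lambda>u. word u c)"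
  using inj_word by (auto simp: inj_def)

lemma code_words_eq: "code_words e c ds = range (\<lambda>u. word u c)"
proof -
  have "code_words e c ds = range (\<lambda>x. \<chi> j. Tr (x * ds j) + c)"
    by (auto simp: code_words_def)
  also have "\<dots> = (\<lambda>x. \<chi> j. Tr (x * ds j) + c) ` range L"
    using bij_L by (simp add: bij_def)
  finally show ?thesis by (simp add: image_image word_def)
qed

lemma trace_scale_left: "\<exists>u'. \<forall>v. Tr (L u' * v) = a * Tr (L u * v)"
proof -
  obtain u' where "L u' = emb a * L u" using bij_L by (metis bij_pointE)
  then have "Tr (L u' * v) = a * Tr (L u * v)" for v by (simp only: mult.assoc trace_scale)
  then show ?thesis by blast
qed

lemma subspace_range_word: "vec.subspace (range (\<lambda>(u, b). word u b))"
proof (rule vec.subspaceI)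
  show "0 \<in> range (\<lambda>(u, b). word u b)"
    using word_eq_0_iff[of 0 0] by (auto intro!: range_eqI[of _ _ "(0, 0)"])
next
  fix x y assume "x \<in> range (\<lambda>(u, b). word u b)" "y \<in> range (\<lambda>(u, b). word u b)"
  then obtain u b u' b' where "x = word u b" "y = word u' b'" by auto
  then have "x + y = (\<lambda>(u, b). word u b) (u + u', b + b')" by (simp add: word_add)
  then show "x + y \<in> range (\<lambda>(u, b). word u b)" by (rule range_eqI)
next
  fix a x assume "x \<in> range (\<lambda>(u, b). word u b)"
  then obtain u b where x: "x = word u b" by auto
  obtain u' where "\<forall>v. Tr (L u' * v) = a * Tr (L u * v)" using trace_scale_left by blast
  then have "a *s x = (\<lambda>(u, b). word u b) (u', a * b)"
    unfolding x by (simp add: word_def vec_eq_iff algebra_simps)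
  then show "a *s x \<in> range (\<lambda>(u, b). word u b)" by (rule range_eqI)
qed

text \<open>The code contains the constant word \<open>word 0 c\<close>; as \<open>c\<close> is
  invertible, its multiples adjust the constant term arbitrarily.\<close>

lemma span_code: "vec.span (range (\<lambda>u. word u c)) = range (\<lambda>(u, b). word u b)"
proof
  show "vec.span (range (\<lambda>u. word u c)) \<subseteq> range (\<lambda>(u, b). word u b)"
    by (intro vec.span_minimal subspace_range_word) auto
  show "range (\<lambda>(u, b). word u b) \<subseteq> vec.span (range (\<lambda>u. word u c))"
  proof clarify
    fix u b
    have "word u c + ((b - c) / c) *s word 0 c \<in> vec.span (range (\<lambda>u. word u c))"
      by (intro vec.span_add vec.span_scale vec.span_base rangeI)
    also have "word u c + ((b - c) / c) *s word 0 c = word u b"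
      using c_nonzero by (simp add: word_def vec_eq_iff)
    finally show "word u b \<in> vec.span (range (\<lambda>u. word u c))" .
  qed
qed

text \<open>The p^e * p pairs \<open>(u, b)\<close> give distinct words, and a subspace of dimension
  k has p^k elements.\<close>

lemma dim_span_code: "vec.dim (vec.span (range (\<lambda>u. word u c))) = e + 1"
proof -
  have "card (range (\<lambda>(u, b). word u b)) = CARD('b \<times> 'p mod_ring)"
    by (rule card_image[OF inj_word])
  also have "\<dots> = P ^ (e + 1)"
    by (simp only: card_prod card_extension CARD_mod_ring power_add power_one_right P_def)
  finally have "P ^ (e + 1) = P ^ vec.dim (range (\<lambda>(u, b). word u b))"
    using vec.card_subspace[OF subspace_range_word] by (simp add: P_def)
  then have "e + 1 = vec.dim (range (\<lambda>(u, b). word u b))"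
    by (rule power_inject_exp[THEN iffD1, rotated]) (use P_gt_2 in simp)
  then show ?thesis unfolding span_code by (rule sym)
qed

section \<open>Weight distribution and complete weight enumerator\<close>

lemma symbol_count_word: "symbol_count (word u c) i = card {j. Tr (L u * ds j) = i - c}"
  by (simp add: symbol_count_def word_def eq_diff_eq)

lemma hamming_weight_word: "hamming_weight (word u c) + card {j. Tr (L u * ds j) = - c} = CARD('n)"
proof -
  have "{j. word u c $ j \<noteq> 0} \<union> {j. Tr (L u * ds j) = - c} = UNIV"
    by (auto simp: word_def eq_neg_iff_add_eq_0)
  moreover have "{j. word u c $ j \<noteq> 0} \<inter> {j. Tr (L u * ds j) = - c} = {}"
    by (auto simp: word_def eq_neg_iff_add_eq_0)
  ultimately show ?thesis
    unfolding hamming_weight_def by (metis card_Un_disjoint finite)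
qed

lemma card_anisotropic: "card anisotropic = (P - 1) * (P * X\<^sup>2 + X)"
proof -
  have "int (card {v. Q v = 1}) = int (P * X\<^sup>2 + X)"
    using card_level_one_X by simp
  then have one: "card {v. Q v = 1} = P * X\<^sup>2 + X" by (simp only: of_nat_eq_iff)
  have "anisotropic = UNIV - {v. Q v = 0}" by (auto simp: anisotropic_def)
  then have "card anisotropic + card {v. Q v = 0} = CARD('b)"
    by (simp add: card_Diff_subset card_mono)
  then show ?thesis
    using form.card_level_sum unfolding one by (simp add: P_def)
qed

text \<open>Serves the multiplicities, as a sum in \<open>nat\<close>, and the enumerator, as a sum
  of polynomials.\<close>

lemma sum_words:
  fixes f :: "'b \<Rightarrow> 'r::semiring_1"
  assumes "\<And>u. u \<in> isotropic \<Longrightarrow> f u = f1" "\<And>u. u \<in> anisotropic \<Longrightarrow> f u = f2"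
  shows "(\<Sum>u\<in>UNIV. f u) = f 0 + of_nat (card isotropic) * f1 + of_nat (card anisotropic) * f2"
proof -
  have "UNIV = insert 0 (isotropic \<union> anisotropic)"
    by (auto simp: isotropic_def anisotropic_def)
  then have "(\<Sum>u\<in>UNIV. f u) = (\<Sum>u\<in>insert 0 (isotropic \<union> anisotropic). f u)" by simp
  also have "\<dots> = f 0 + (\<Sum>u\<in>isotropic \<union> anisotropic. f u)"
    by (rule sum.insert) (auto simp: isotropic_def anisotropic_def form.Q_zero)
  also have "(\<Sum>u\<in>isotropic \<union> anisotropic. f u) = (\<Sum>u\<in>isotropic. f u) + (\<Sum>u\<in>anisotropic. f u)"
    by (rule sum.union_disjoint) (auto simp: isotropic_def anisotropic_def)
  also have "(\<Sum>u\<in>isotropic. f u) = of_nat (card isotropic) * f1"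
    using assms(1) by simp
  also have "(\<Sum>u\<in>anisotropic. f u) = of_nat (card anisotropic) * f2"
    using assms(2) by simp
  finally show ?thesis by (simp only: add.assoc)
qed

lemma hamming_weight_zero_word: "hamming_weight (word 0 c) = CARD('n)"
  using hamming_weight_word[of 0] c_nonzero by simp

lemma hamming_weight_isotropic:
  assumes "u \<in> isotropic"
  shows "hamming_weight (word u c) + X\<^sup>2 = CARD('n)"
  using hamming_weight_word[of u] card_isotropic_word(2)[OF assms, of "- c"] c_nonzero by simp

lemma hamming_weight_anisotropic:
  assumes "u \<in> anisotropic"
  shows "hamming_weight (word u c) + X\<^sup>2 = CARD('n) + X"
  using hamming_weight_word[of u] card_anisotropic_word(2)[OF assms, of "- c"] c_nonzero by simp

text \<open>The sum of indicators is correct even for coinciding weights; their distinctness is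
  settled only in the theorem.\<close>

lemma weight_multiplicity_code:
  assumes "w1 + X\<^sup>2 = CARD('n)" "w2 + X\<^sup>2 = CARD('n) + X"
  shows "weight_multiplicity (range (\<lambda>u. word u c)) w =
    of_bool (w = CARD('n)) + card isotropic * of_bool (w = w1) + card anisotropic * of_bool (w = w2)"
proof -
  have "{v \<in> range (\<lambda>u. word u c). hamming_weight v = w}
      = (\<lambda>u. word u c) ` {u. w = hamming_weight (word u c)}" by blast
  then have "weight_multiplicity (range (\<lambda>u. word u c)) w = card {u. w = hamming_weight (word u c)}"
    unfolding weight_multiplicity_def
    by (simp add: card_image inj_on_subset[OF inj_word_c])
  also have "\<dots> = (\<Sum>u\<in>UNIV. of_bool (w = hamming_weight (word u c)))" by simp
  also have "\<dots> = of_bool (w = hamming_weight (word 0 c)) + of_nat (card isotropic) * of_bool (w = w1)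
      + of_nat (card anisotropic) * of_bool (w = w2)"
  proof (rule sum_words)
    fix u assume "u \<in> isotropic"
    then show "of_bool (w = hamming_weight (word u c)) = (of_bool (w = w1) :: nat)"
      using hamming_weight_isotropic[of u] assms(1) by auto
  next
    fix u assume "u \<in> anisotropic"
    then show "of_bool (w = hamming_weight (word u c)) = (of_bool (w = w2) :: nat)"
      using hamming_weight_anisotropic[of u] assms(2) by auto
  qed
  finally show ?thesis unfolding hamming_weight_zero_word by simp
qed

text \<open>Adding \<open>c\<close> moves the exceptional trace value 0 to the symbol
  \<open>c\<close>.\<close>

lemma word_monomial:
  assumes "card {j. Tr (L u * ds j) = 0} = s" "\<And>b. b \<noteq> 0 \<Longrightarrow> card {j. Tr (L u * ds j) = b} = t"
  shows "(\<Prod>i\<in>UNIV. unknown i ^ symbol_count (word u c) i)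
    = unknown c ^ s * (\<Prod>i\<in>UNIV - {c}. unknown i ^ t)"
proof -
  have "(\<Prod>i\<in>UNIV - {c}. unknown i ^ symbol_count (word u c) i) = (\<Prod>i\<in>UNIV - {c}. unknown i ^ t)"
    using assms(2) by (intro prod.cong) (auto simp: symbol_count_word)
  then show ?thesis
    using assms(1) by (subst prod.remove[of _ c]) (simp_all add: symbol_count_word)
qed

lemma complete_weight_enumerator_code:
  assumes "s1 + (P - 1) * X + 1 = X\<^sup>2" "s2 + 1 = X\<^sup>2" "t2 + X = X\<^sup>2"
  shows "complete_weight_enumerator (range (\<lambda>u. word u c))
    = unknown c ^ CARD('n)
      + of_nat (card isotropic) * (unknown c ^ s1 * (\<Prod>i\<in>UNIV - {c}. unknown i ^ X\<^sup>2))
      + of_nat (card anisotropic) * (unknown c ^ s2 * (\<Prod>i\<in>UNIV - {c}. unknown i ^ t2))"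
proof -
  have "complete_weight_enumerator (range (\<lambda>u. word u c))
      = (\<Sum>u\<in>UNIV. \<Prod>i\<in>UNIV. unknown i ^ symbol_count (word u c) i)"
    unfolding complete_weight_enumerator_def by (simp add: sum.reindex[OF inj_word_c])
  also have "\<dots> = (\<Prod>i\<in>UNIV. unknown i ^ symbol_count (word 0 c) i)
      + of_nat (card isotropic) * (unknown c ^ s1 * (\<Prod>i\<in>UNIV - {c}. unknown i ^ X\<^sup>2))
      + of_nat (card anisotropic) * (unknown c ^ s2 * (\<Prod>i\<in>UNIV - {c}. unknown i ^ t2))"
  proof (rule sum_words)
    fix u assume u: "u \<in> isotropic"
    have "card {j. Tr (L u * ds j) = 0} = s1"
      using card_isotropic_word(1)[OF u] assms(1) by linarith
    then show "(\<Prod>i\<in>UNIV. unknown i ^ symbol_count (word u c) i)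
        = unknown c ^ s1 * (\<Prod>i\<in>UNIV - {c}. unknown i ^ X\<^sup>2)"
      by (rule word_monomial) (rule card_isotropic_word(2)[OF u])
  next
    fix u assume u: "u \<in> anisotropic"
    have "card {j. Tr (L u * ds j) = 0} = s2"
      using card_anisotropic_word(1)[OF u] assms(2) by linarith
    moreover have "card {j. Tr (L u * ds j) = b} = t2" if "b \<noteq> 0" for b
      using card_anisotropic_word(2)[OF u that] assms(3) by linarith
    ultimately show "(\<Prod>i\<in>UNIV. unknown i ^ symbol_count (word u c) i)
        = unknown c ^ s2 * (\<Prod>i\<in>UNIV - {c}. unknown i ^ t2)"
      by (rule word_monomial)
  qed
  \<comment> \<open>For \<open>u = 0\<close> every trace is 0, so all other unknowns get exponent
    0.\<close>
  also have "(\<Prod>i\<in>UNIV. unknown i ^ symbol_count (word 0 c) i) = unknown c ^ CARD('n)"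
    by (subst word_monomial[of 0 "CARD('n)" 0]) simp_all
  finally show ?thesis .
qed

end

theorem theorem2p1:
  fixes p m \<alpha> e d :: nat
    and c :: "'p::prime_card mod_ring"
    and ds :: "'n::finite \<Rightarrow> 'b::{field,finite}"
    and C :: "('p mod_ring ^ 'n) set"
  assumes "p = CARD('p)" and "odd p"
    and "m > 0" and "\<alpha> > 0"
    and "e = 2 * m" and "CARD('b) = p ^ e" and "d = gcd \<alpha> e"
    and "d dvd m" and "odd (m div d)"
    and "c \<noteq> 0"
    and "bij_betw ds UNIV (defining_set TYPE('p) e \<alpha>)"
    and "C = code_words e c ds"
  shows "linear_code (p ^ (e - 1) - (p - 1) * p ^ (m - 1) - 1) (e + 1) (vec.span C)
    \<and> weight_multiplicity C ((p - 1) * (p ^ (e - 2) - p ^ (m - 1)) - 1)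
        = p ^ (e - 1) - (p - 1) * p ^ (m - 1) - 1
    \<and> weight_multiplicity C ((p - 1) * p ^ (e - 2) - (p - 2) * p ^ (m - 1) - 1)
        = (p - 1) * (p ^ (e - 1) + p ^ (m - 1))
    \<and> weight_multiplicity C (p ^ (e - 1) - (p - 1) * p ^ (m - 1) - 1) = 1
    \<and> (\<forall>w. w \<notin> {(p - 1) * (p ^ (e - 2) - p ^ (m - 1)) - 1,
                (p - 1) * p ^ (e - 2) - (p - 2) * p ^ (m - 1) - 1,
                p ^ (e - 1) - (p - 1) * p ^ (m - 1) - 1}
          \<longrightarrow> weight_multiplicity C w = 0)
    \<and> complete_weight_enumerator C =
        unknown c ^ (p ^ (e - 1) - (p - 1) * p ^ (m - 1) - 1)
        + of_nat (p ^ (e - 1) - (p - 1) * p ^ (m - 1) - 1)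
            * unknown c ^ (p ^ (e - 2) - (p - 1) * p ^ (m - 1) - 1)
            * (\<Prod>i\<in>UNIV - {c}. unknown i ^ (p ^ (e - 2)))
        + of_nat ((p - 1) * (p ^ (e - 1) + p ^ (m - 1)))
            * unknown c ^ (p ^ (e - 2) - 1)
            * (\<Prod>i\<in>UNIV - {c}. unknown i ^ (p ^ (e - 2) - p ^ (m - 1)))"
proof -
  define x where "x = p ^ (m - 1)"
  interpret trace_form_code e "TYPE('p)" "TYPE('b)" m \<alpha> d c ds p x
    using assms by unfold_locales (simp_all add: x_def)
  have C: "C = range (\<lambda>u. word u c)" using assms(12) code_words_eq by simp
  obtain k where k: "m = Suc k" using \<open>m > 0\<close> by (cases m) auto
  have p1: "p ^ (e - 1) = p * x\<^sup>2" and p2: "p ^ (e - 2) = x\<^sup>2"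
    unfolding x_def k \<open>e = 2 * m\<close> by (simp_all add: mult.commute flip: power_mult)
  have p: "p > 2" by (rule P_gt_2)
  have x2: "x < x\<^sup>2" by (rule X_less_square)
  \<comment> \<open>Writing p as \<open>r + 2\<close> removes the subtractions in
    \<open>p - 1\<close> and \<open>p - 2\<close>.\<close>
  obtain r where r: "p = r + 2" using p by (metis add.commute le_Suc_ex less_imp_le)
  have len: "CARD('n) + (p - 1) * x + 1 = p * x\<^sup>2" by (rule length_eq)
  have n: "p * x\<^sup>2 - (p - 1) * x - 1 = CARD('n)" using len by linarith
  define w1 where "w1 = (p - 1) * (x\<^sup>2 - x) - 1"
  define w2 where "w2 = (p - 1) * x\<^sup>2 - (p - 2) * x - 1"
  define s1 where "s1 = x\<^sup>2 - (p - 1) * x - 1"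
  have iso: "card isotropic = CARD('n)" using card_index by simp
  have aniso: "card anisotropic = (p - 1) * (p * x\<^sup>2 + x)" by (rule card_anisotropic)
  \<comment> \<open>An actual isotropic word realizes the parameters \<open>s1\<close> and
    \<open>w1\<close>, which shows that their subtractions do not truncate.\<close>
  have ne: "isotropic \<noteq> {}" using iso by (metis card.empty card_gt_0_iff finite UNIV_not_empty less_irrefl)
  then obtain u where u: "u \<in> isotropic" by blast
  have s1: "s1 + (p - 1) * x + 1 = x\<^sup>2"
    using card_isotropic_word(1)[OF u] unfolding s1_def by linarith
  have w1: "w1 + x\<^sup>2 = CARD('n)"
  proof -
    have "hamming_weight (word u c) + (p - 1) * x + 1 = (p - 1) * x\<^sup>2"
      using hamming_weight_isotropic[OF u] len unfolding r by (simp add: algebra_simps)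
    then have "w1 = hamming_weight (word u c)"
      unfolding w1_def diff_mult_distrib2 by linarith
    then show ?thesis using hamming_weight_isotropic[OF u] by simp
  qed
  have w2: "w2 + x\<^sup>2 = CARD('n) + x"
  proof -
    have "w1 + x + (p - 2) * x + 1 = (p - 1) * x\<^sup>2"
      using w1 len unfolding r by (simp add: algebra_simps)
    then have "w2 = w1 + x" unfolding w2_def by linarith
    then show ?thesis using w1 by simp
  qed
  note mult = weight_multiplicity_code[unfolded iso aniso, OF w1 w2, folded C]
  \<comment> \<open>The weights are n - x^2, n - x^2 + x and n for the length n, and 0 < x <
    x^2.\<close>
  have dist: "w1 \<noteq> w2 \<and> w1 \<noteq> CARD('n) \<and> w2 \<noteq> CARD('n)"
    using w1 w2 x2 X_gt_1 by (intro conjI notI) linarith+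
  have cwe: "complete_weight_enumerator C = unknown c ^ CARD('n)
      + of_nat CARD('n) * (unknown c ^ s1 * (\<Prod>i\<in>UNIV - {c}. unknown i ^ x\<^sup>2))
      + of_nat ((p - 1) * (p * x\<^sup>2 + x))
        * (unknown c ^ (x\<^sup>2 - 1) * (\<Prod>i\<in>UNIV - {c}. unknown i ^ (x\<^sup>2 - x)))"
    using complete_weight_enumerator_code[unfolded iso aniso, OF s1, of "x\<^sup>2 - 1" "x\<^sup>2 - x", folded C] x2
    by linarith
  have lin: "linear_code CARD('n) (e + 1) (vec.span C)"
    unfolding linear_code_def C using dim_span_code by simp
  show ?thesis
    unfolding p1 p2 x_def[symmetric] n w1_def[symmetric] w2_def[symmetric] s1_def[symmetric]
    using lin dist by (auto simp: mult cwe mult.assoc)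
qed

end
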